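(* Let $A=kQ/I$ be a quadratic monomial algebra, let $\mathbf{F}$ be the set of minimal paths among the paths in $I$, and let $\alpha$ be an arrow of $Q$. Then the following statements hold. (1) $L(\alpha)=\{\beta\in Q_1\mid s(\beta)=t(\alpha)\text{ and }\beta\alpha\in\mathbf{F}\}$, and $R(\alpha)=\{\beta\in Q_1\mid t(\beta)=s(\alpha)\text{ and }\alpha\beta\in\mathbf{F}\}$. (2) Assume that $\beta$ is an arrow with $t(\beta)=s(\alpha)$. Then the pair $(\alpha,\beta)$ is perfect if and only if there is an arrow $[\alpha\beta]$ from $\beta$ to $\alpha$ in the relation quiver $\mathcal{R}_A$, which is the unique arrow starting at $\beta$ and also the unique arrow terminating at $\alpha$. (3) The arrow $\alpha$ is perfect (i.e. is a perfect path in $A$) if and only if the corresponding vertex belongs to a perfect component of $\mathcal{R}_A$.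
   Context: Let $k$ be a field and $Q$ a finite quiver with arrow set $Q_1$. Paths are written from right to left: a path of length $n$ is $p=\alpha_n\cdots\alpha_2\alpha_1$ with arrows satisfying $s(\alpha_i)=t(\alpha_{i-1})$, and $s(p)$, $t(p)$ denote its starting and terminating vertices; a path is nontrivial if its length is at least one; $pq$ is the concatenation when $s(p)=t(q)$. A two-sided ideal $I$ of the path algebra $kQ$ is admissible if $J^d\subseteq I\subseteq J^2$ for some $d\ge 2$, where $J$ is the ideal generated by all arrows. $A=kQ/I$ is a quadratic monomial algebra if $I$ is admissible and generated by (some) paths of length two; equivalently, $I$ is admissible and generated by paths, and the set $\mathbf{F}$ of paths in $I$ having no proper sub-path in $I$ consists of paths of length two. A path $p$ is a nonzero path in $A$ if $p\notin I$; if a path $p$ lies in $I$ one writes $p=0$ in $A$. For a set $S$ of paths, a path $p\in S$ is left-minimal in $S$ if there is no $q\in S$ with $p=qp'$ for some nontrivial path $p'$, and right-minimal in $S$ if there is no $q\in S$ with $p=p'q$ for some nontrivial path $p'$. For a nonzero nontrivial path $p$, $L(p)$ is the set of right-minimal paths in $\{\text{nonzero paths }q\mid s(q)=t(p),\ qp=0\}$, and $R(p)$ is the set of left-minimal paths in $\{\text{nonzero paths }q\mid t(q)=s(p),\ pq=0\}$. A pair $(p,q)$ of nonzero paths in $A$ is perfect if: (P1) both are nontrivial, $s(p)=t(q)$ and $pq=0$ in $A$; (P2) if $pq'=0$ in $A$ for a nonzero path $q'$ with $t(q')=s(p)$, then $q'=qq''$ for some path $q''$ (in other words $R(p)=\{q\}$);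 (P3) if $p'q=0$ in $A$ for a nonzero path $p'$ with $s(p')=t(q)$, then $p'=p''p$ for some path $p''$ (in other words $L(q)=\{p\}$). A nonzero path $p$ is a perfect path if there is a sequence $p=p_1,p_2,\dots,p_n,p_{n+1}=p$ ($n\ge 1$) of nonzero paths such that $(p_i,p_{i+1})$ is a perfect pair for all $1\le i\le n$. The relation quiver $\mathcal{R}_A$ has as vertices the arrows of $Q$, and there is an arrow $[\beta\alpha]\colon\alpha\to\beta$ whenever $t(\alpha)=s(\beta)$ and $\beta\alpha\in I$ (equivalently $\beta\alpha\in\mathbf{F}$). A basic $n$-cycle ($n\ge 1$) is a quiver consisting of $n$ vertices and $n$ arrows which form an oriented cycle. A connected component of $\mathcal{R}_A$ is called a perfect component if it is a basic cycle. *)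

theory Defs
  imports "Graph_Theory.Digraph_Component" "HOL-Algebra.Ideal_Product"
begin

text \<open>
  A quiver is a digraph \<open>Q :: ('v, 'a) pre_digraph\<close> in which loops and parallel arrows are
  allowed; a finite quiver is one satisfying \<^const>\<open>fin_digraph\<close>.

  A path is stored as its starting vertex together with the list of its arrows in the order in
  which they are traversed, as for \<^const>\<open>pre_digraph.awalk\<close>. So the path written
  \<open>\<alpha>\<^sub>n \<cdots> \<alpha>\<^sub>2 \<alpha>\<^sub>1\<close> is the pair of \<open>s(\<alpha>\<^sub>1)\<close> and \<open>[\<alpha>\<^sub>1, \<alpha>\<^sub>2, \<dots>, \<alpha>\<^sub>n]\<close>, and the trivial path at
  \<open>v\<close> is \<open>(v, [])\<close>.
\<close>

type_synonym ('v, 'a) qpath = "'v \<times> 'a list"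

abbreviation source :: "('v, 'a) qpath \<Rightarrow> 'v"
  where "source p \<equiv> fst p"

definition target :: "('v, 'a) pre_digraph \<Rightarrow> ('v, 'a) qpath \<Rightarrow> 'v"
  where "target Q p = last (pre_digraph.awalk_verts Q (fst p) (snd p))"

abbreviation path_length :: "('v, 'a) qpath \<Rightarrow> nat"
  where "path_length p \<equiv> length (snd p)"

abbreviation nontrivial :: "('v, 'a) qpath \<Rightarrow> bool"
  where "nontrivial p \<equiv> 1 \<le> path_length p"

definition paths :: "('v, 'a) pre_digraph \<Rightarrow> ('v, 'a) qpath set"
  where "paths Q = {p. pre_digraph.awalk Q (source p) (snd p) (target Q p)}"

definition arrow_path :: "('v, 'a) pre_digraph \<Rightarrow> 'a \<Rightarrow> ('v, 'a) qpath"
  where "arrow_path Q \<alpha> = (tail Q \<alpha>, [\<alpha>])"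

text \<open>
  The concatenation \<open>p \<diamondop> q\<close> (first \<open>q\<close>, then \<open>p\<close>) is meaningful only if
  \<open>source p = target Q q\<close>, which is required wherever it is used.
\<close>

definition concat_path :: "('v, 'a) qpath \<Rightarrow> ('v, 'a) qpath \<Rightarrow> ('v, 'a) qpath"  (infixr \<open>\<diamondop>\<close> 75)
  where "p \<diamondop> q = (source q, snd q @ snd p)"

definition subpath :: "('v, 'a) pre_digraph \<Rightarrow> ('v, 'a) qpath \<Rightarrow> ('v, 'a) qpath \<Rightarrow> bool"
  where "subpath Q q p \<longleftrightarrow> q \<in> paths Q \<and>
    (\<exists>u \<in> paths Q. \<exists>v \<in> paths Q. source u = target Q q \<and> source q = target Q v \<and> p = u \<diamondop> q \<diamondop> v)"


subsection \<open>The path algebra\<close>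

definition factorizations :: "('v, 'a) pre_digraph \<Rightarrow> ('v, 'a) qpath
    \<Rightarrow> (('v, 'a) qpath \<times> ('v, 'a) qpath) set"
  where "factorizations Q p =
    {(q, r). q \<in> paths Q \<and> r \<in> paths Q \<and> source q = target Q r \<and> q \<diamondop> r = p}"

text \<open>
  Elements of \<open>kQ\<close> are coefficient functions of finite support on the set of paths. Outside
  that set they are required to vanish, so that equality of elements is equality of functions.
\<close>

definition path_algebra :: "('k, 'm) ring_scheme \<Rightarrow> ('v, 'a) pre_digraph
    \<Rightarrow> (('v, 'a) qpath \<Rightarrow> 'k) ring"
  where "path_algebra K Q =
    \<lparr>carrier = {f. (\<forall>p \<in> paths Q. f p \<in> carrier K) \<and> (\<forall>p. p \<notin> paths Q \<longrightarrow> f p = \<zero>\<^bsub>K\<^esub>)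
                   \<and> finite {p. f p \<noteq> \<zero>\<^bsub>K\<^esub>}},
     mult = (\<lambda>f g p. \<Oplus>\<^bsub>K\<^esub>z\<in>factorizations Q p. f (fst z) \<otimes>\<^bsub>K\<^esub> g (snd z)),
     one = (\<lambda>p. if p \<in> paths Q \<and> path_length p = 0 then \<one>\<^bsub>K\<^esub> else \<zero>\<^bsub>K\<^esub>),
     zero = (\<lambda>p. \<zero>\<^bsub>K\<^esub>),
     add = (\<lambda>f g p. f p \<oplus>\<^bsub>K\<^esub> g p)\<rparr>"

definition path_elem :: "('k, 'm) ring_scheme \<Rightarrow> ('v, 'a) qpath \<Rightarrow> ('v, 'a) qpath \<Rightarrow> 'k"
  where "path_elem K p = (\<lambda>q. if q = p then \<one>\<^bsub>K\<^esub> else \<zero>\<^bsub>K\<^esub>)"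

text \<open>
  The path algebra of a finite quiver is a ring with one, so that the notions of
  \<^locale>\<open>ideal\<close> and \<^const>\<open>genideal\<close>, which presuppose this, are meaningful for it. Two-sided
  ideals of this ring are automatically \<open>k\<close>-subspaces.
\<close>

lemma paths_concat:
  assumes "fin_digraph Q" "source q = target Q r"
  shows "q \<diamondop> r \<in> paths Q \<longleftrightarrow> q \<in> paths Q \<and> r \<in> paths Q" "target Q (q \<diamondop> r) = target Q q"
proof -
  interpret fin_digraph Q by fact
  show "target Q (q \<diamondop> r) = target Q q"
    using assms(2) by (simp add: target_def concat_path_def awlast_append)
  then show "q \<diamondop> r \<in> paths Q \<longleftrightarrow> q \<in> paths Q \<and> r \<in> paths Q"
    using assms(2) by (auto simp: paths_def target_def concat_path_def)
qed

lemma finite_factorizations: "finite (factorizations Q p)"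
proof (rule finite_subset)
  let ?r = "\<lambda>i. (fst p, take i (snd p))"
  show "factorizations Q p \<subseteq> (\<lambda>i. ((target Q (?r i), drop i (snd p)), ?r i)) ` {..length (snd p)}"
  proof
    fix z assume "z \<in> factorizations Q p"
    then show "z \<in> (\<lambda>i. ((target Q (?r i), drop i (snd p)), ?r i)) ` {..length (snd p)}"
      by (intro image_eqI[where x = "length (snd (snd z))"])
        (auto simp: factorizations_def concat_path_def)
  qed
qed simp

lemma (in abelian_monoid) finsum_Sigma:
  assumes "finite A" "\<And>x. x \<in> A \<Longrightarrow> finite (B x)"
    and "\<And>x y. x \<in> A \<Longrightarrow> y \<in> B x \<Longrightarrow> g x y \<in> carrier G"
  shows "(\<Oplus>x\<in>A. \<Oplus>y\<in>B x. g x y) = (\<Oplus>z\<in>Sigma A B. case_prod g z)"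
proof -
  have "(\<Oplus>z\<in>(\<Union>x\<in>A. Pair x ` B x). case_prod g z) = (\<Oplus>x\<in>A. \<Oplus>z\<in>Pair x ` B x. case_prod g z)"
    by (rule add.finprod_UN_disjoint) (use assms in \<open>auto simp: pairwise_def disjnt_def\<close>)
  also have "\<dots> = (\<Oplus>x\<in>A. \<Oplus>y\<in>B x. g x y)"
  proof (rule finsum_cong')
    fix x assume "x \<in> A"
    then show "(\<Oplus>z\<in>Pair x ` B x. case_prod g z) = (\<Oplus>y\<in>B x. g x y)"
      by (subst finsum_reindex) (use assms in \<open>auto simp: inj_on_def\<close>)
  qed (use assms in auto)
  also have "(\<Union>x\<in>A. Pair x ` B x) = Sigma A B" by auto
  finally show ?thesis by simp
qed

lemma ring_path_algebra:
  fixes Q :: "('c, 'd) pre_digraph"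
  assumes "field K" "fin_digraph Q"
  shows "ring (path_algebra K Q)"
proof -
  interpret K: field K by fact
  interpret Q: fin_digraph Q by fact
  let ?A = "path_algebra K Q"
  have carr: "f p \<in> carrier K" if "f \<in> carrier ?A" for f p
    using that by (cases p; cases "p \<in> paths Q") (auto simp: path_algebra_def)
  have mult_app: "(g \<otimes>\<^bsub>?A\<^esub> h) p = (\<Oplus>\<^bsub>K\<^esub>z\<in>factorizations Q p. g (fst z) \<otimes>\<^bsub>K\<^esub> h (snd z))" for g h p
    by (simp add: path_algebra_def)
  have add_app: "(g \<oplus>\<^bsub>?A\<^esub> h) p = g p \<oplus>\<^bsub>K\<^esub> h p" and zero_app: "\<zero>\<^bsub>?A\<^esub> p = \<zero>\<^bsub>K\<^esub>" for g h p
    by (simp_all add: path_algebra_def)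
  have mult_closed: "f \<otimes>\<^bsub>?A\<^esub> g \<in> carrier ?A"
    if f: "f \<in> carrier ?A" and g: "g \<in> carrier ?A" for f g
  proof -
    have c: "(f \<otimes>\<^bsub>?A\<^esub> g) p \<in> carrier K" for p
      using carr[OF f] carr[OF g] by (auto simp: path_algebra_def intro!: K.finsum_closed)
    have z: "(f \<otimes>\<^bsub>?A\<^esub> g) p = \<zero>\<^bsub>K\<^esub>" if "p \<notin> paths Q" for p
    proof -
      have "factorizations Q p = {}"
        using that paths_concat(1)[OF assms(2)] by (fastforce simp: factorizations_def)
      then show ?thesis by (simp add: path_algebra_def)
    qed
    have "{p. (f \<otimes>\<^bsub>?A\<^esub> g) p \<noteq> \<zero>\<^bsub>K\<^esub>}
        \<subseteq> (\<lambda>(q, r). q \<diamondop> r) ` ({q. f q \<noteq> \<zero>\<^bsub>K\<^esub>} \<times> {r. g r \<noteq> \<zero>\<^bsub>K\<^esub>})" (is "_ \<subseteq> ?S")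
    proof
      fix p assume p: "p \<in> {p. (f \<otimes>\<^bsub>?A\<^esub> g) p \<noteq> \<zero>\<^bsub>K\<^esub>}"
      show "p \<in> ?S"
      proof (rule ccontr)
        assume "p \<notin> ?S"
        then have "f (fst z) = \<zero>\<^bsub>K\<^esub> \<or> g (snd z) = \<zero>\<^bsub>K\<^esub>" if "z \<in> factorizations Q p" for z
          using that by (force simp: factorizations_def)
        then have "f (fst z) \<otimes>\<^bsub>K\<^esub> g (snd z) = \<zero>\<^bsub>K\<^esub>" if "z \<in> factorizations Q p" for z
          using that K.l_null[OF carr[OF g]] K.r_null[OF carr[OF f]] by metis
        then have "(f \<otimes>\<^bsub>?A\<^esub> g) p = \<zero>\<^bsub>K\<^esub>"
          by (auto simp: path_algebra_def intro!: K.add.finprod_one_eqI)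
        then show False using p by simp
      qed
    qed
    moreover have "finite ?S" using f g by (simp add: path_algebra_def)
    ultimately have "finite {p. (f \<otimes>\<^bsub>?A\<^esub> g) p \<noteq> \<zero>\<^bsub>K\<^esub>}" by (rule finite_subset)
    with c z show ?thesis by (subst path_algebra_def) simp
  qed
  have assoc: "(f \<otimes>\<^bsub>?A\<^esub> g) \<otimes>\<^bsub>?A\<^esub> h = f \<otimes>\<^bsub>?A\<^esub> (g \<otimes>\<^bsub>?A\<^esub> h)"
    if f: "f \<in> carrier ?A" and g: "g \<in> carrier ?A" and h: "h \<in> carrier ?A" for f g h
  proof
    fix p
    let ?D = "factorizations Q"
    note [simp] = finite_factorizations carr[OF f] carr[OF g] carr[OF h]
    have [simp]: "source (q \<diamondop> r) = source r" "(q \<diamondop> r) \<diamondop> s = q \<diamondop> (r \<diamondop> s)"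
      for q r s :: "('c, 'd) qpath"
      by (simp_all add: concat_path_def)
    let ?l = "\<lambda>((x, r), (q, s)). (f q \<otimes>\<^bsub>K\<^esub> g s) \<otimes>\<^bsub>K\<^esub> h r"
    let ?r = "\<lambda>((q, y), (s, r)). f q \<otimes>\<^bsub>K\<^esub> (g s \<otimes>\<^bsub>K\<^esub> h r)"
    let ?\<phi> = "\<lambda>((x, r), (q, s)). ((q, s \<diamondop> r), (s, r))"
    let ?SL = "Sigma (?D p) (\<lambda>(x, r). ?D x)"
    let ?SR = "Sigma (?D p) (\<lambda>(q, y). ?D y)"
    have "((f \<otimes>\<^bsub>?A\<^esub> g) \<otimes>\<^bsub>?A\<^esub> h) p
        = (\<Oplus>\<^bsub>K\<^esub>z\<in>?D p. \<Oplus>\<^bsub>K\<^esub>w\<in>(case z of (x, r) \<Rightarrow> ?D x). ?l (z, w))"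
      by (auto simp: path_algebra_def split_def K.finsum_ldistr intro!: K.finsum_cong')
    also have "\<dots> = (\<Oplus>\<^bsub>K\<^esub>z\<in>?SL. ?l z)"
      by (subst K.finsum_Sigma) (auto simp: split_def intro!: K.finsum_cong')
    also have "\<dots> = (\<Oplus>\<^bsub>K\<^esub>z\<in>?SL. ?r (?\<phi> z))"
      by (auto simp: split_def K.m_assoc intro!: K.finsum_cong')
    also have "\<dots> = (\<Oplus>\<^bsub>K\<^esub>z\<in>?\<phi> ` ?SL. ?r z)"
    proof (rule K.finsum_reindex[symmetric])
      show "inj_on ?\<phi> ?SL"
        by (auto simp: inj_on_def factorizations_def)
    qed auto
    also have "?\<phi> ` ?SL = ?SR"
    proof (intro equalityI subsetI)
      fix z assume "z \<in> ?\<phi> ` ?SL"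
      then obtain x r q s where z: "z = ((q, s \<diamondop> r), (s, r))" "(x, r) \<in> ?D p" "(q, s) \<in> ?D x"
        by auto
      then have "x = q \<diamondop> s" by (simp add: factorizations_def)
      with z show "z \<in> ?SR" by (simp add: factorizations_def paths_concat[OF assms(2)])
    next
      fix z assume "z \<in> ?SR"
      then obtain q y s r where z: "z = ((q, y), (s, r))" "(q, y) \<in> ?D p" "(s, r) \<in> ?D y"
        by auto
      then have y: "y = s \<diamondop> r" by (simp add: factorizations_def)
      then have "z = ?\<phi> ((q \<diamondop> s, r), (q, s))" using z(1) by simp
      moreover have "((q \<diamondop> s, r), (q, s)) \<in> ?SL"
        using z(2,3) y by (simp add: factorizations_def paths_concat[OF assms(2)])
      ultimately show "z \<in> ?\<phi> ` ?SL" by blast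
    qed
    also have "(\<Oplus>\<^bsub>K\<^esub>z\<in>?SR. ?r z)
        = (\<Oplus>\<^bsub>K\<^esub>z\<in>?D p. \<Oplus>\<^bsub>K\<^esub>w\<in>(case z of (q, y) \<Rightarrow> ?D y). ?r (z, w))"
      by (subst K.finsum_Sigma) (auto simp: split_def intro!: K.finsum_cong')
    also have "\<dots> = (f \<otimes>\<^bsub>?A\<^esub> (g \<otimes>\<^bsub>?A\<^esub> h)) p"
      by (auto simp: path_algebra_def split_def K.finsum_rdistr intro!: K.finsum_cong')
    finally show "((f \<otimes>\<^bsub>?A\<^esub> g) \<otimes>\<^bsub>?A\<^esub> h) p = (f \<otimes>\<^bsub>?A\<^esub> (g \<otimes>\<^bsub>?A\<^esub> h)) p" .
  qed
  have one_closed: "\<one>\<^bsub>?A\<^esub> \<in> carrier ?A"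
  proof -
    have "{p \<in> paths Q. path_length p = 0} \<subseteq> verts Q \<times> {[]}"
      by (auto simp: paths_def Q.awalk_def)
    then have "finite {p \<in> paths Q. path_length p = 0}"
      by (rule finite_subset) simp
    then have "finite {p. p \<in> paths Q \<and> snd p = []}" by simp
    then show ?thesis
      by (auto simp: path_algebra_def elim!: rev_finite_subset)
  qed
  have one_l: "\<one>\<^bsub>?A\<^esub> \<otimes>\<^bsub>?A\<^esub> f = f" and one_r: "f \<otimes>\<^bsub>?A\<^esub> \<one>\<^bsub>?A\<^esub> = f" if f: "f \<in> carrier ?A" for f
  proof -
    note [simp] = finite_factorizations carr[OF f]
    have z: "f p = \<zero>\<^bsub>K\<^esub>" if "p \<notin> paths Q" for p
      using that f by (simp add: path_algebra_def del: split_paired_All)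
    have z': "factorizations Q p = {}" if "p \<notin> paths Q" for p
      using that paths_concat(1)[OF assms(2)] by (fastforce simp: factorizations_def)
    have one_app: "\<one>\<^bsub>?A\<^esub> q = (if snd q = [] then \<one>\<^bsub>K\<^esub> else \<zero>\<^bsub>K\<^esub>)" if "q \<in> paths Q" for q
      using that by (simp add: path_algebra_def)
    have triv: "(v, []) \<in> paths Q \<longleftrightarrow> v \<in> verts Q" for v
      by (auto simp: paths_def Q.awalk_def target_def)
    have tgt: "target Q (v, []) = v" for v
      by (simp add: target_def)
    have ends: "source p \<in> verts Q" "target Q p \<in> verts Q" if "p \<in> paths Q" for p
      using that by (auto simp: paths_def)
    show "\<one>\<^bsub>?A\<^esub> \<otimes>\<^bsub>?A\<^esub> f = f"
    proof
      fix p show "(\<one>\<^bsub>?A\<^esub> \<otimes>\<^bsub>?A\<^esub> f) p = f p"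
      proof (cases "p \<in> paths Q")
        case True
        let ?z = "((target Q p, []), p)"
        have "(\<one>\<^bsub>?A\<^esub> \<otimes>\<^bsub>?A\<^esub> f) p
            = (\<Oplus>\<^bsub>K\<^esub>z\<in>factorizations Q p. if z = ?z then f (snd z) else \<zero>\<^bsub>K\<^esub>)"
          unfolding mult_app
        proof (rule K.finsum_cong'[OF refl])
          fix z assume "z \<in> factorizations Q p"
          then obtain q r where qr: "z = (q, r)" "q \<in> paths Q" "source q = target Q r" "q \<diamondop> r = p"
            by (auto simp: factorizations_def)
          have "snd q = [] \<longleftrightarrow> z = ?z"
            using qr by (cases q; cases r) (auto simp: concat_path_def)
          then show "\<one>\<^bsub>?A\<^esub> (fst z) \<otimes>\<^bsub>K\<^esub> f (snd z) = (if z = ?z then f (snd z) else \<zero>\<^bsub>K\<^esub>)"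
            using qr by (simp add: one_app)
        qed simp
        also have "\<dots> = f p"
          using True ends[OF True] finite_factorizations[of Q p]
          by (subst K.add.finprod_singleton_swap)
            (simp_all add: factorizations_def concat_path_def triv)
        finally show ?thesis .
      qed (simp add: z z' mult_app)
    qed
    show "f \<otimes>\<^bsub>?A\<^esub> \<one>\<^bsub>?A\<^esub> = f"
    proof
      fix p show "(f \<otimes>\<^bsub>?A\<^esub> \<one>\<^bsub>?A\<^esub>) p = f p"
      proof (cases "p \<in> paths Q")
        case True
        let ?z = "(p, (source p, []))"
        have "(f \<otimes>\<^bsub>?A\<^esub> \<one>\<^bsub>?A\<^esub>) p
            = (\<Oplus>\<^bsub>K\<^esub>z\<in>factorizations Q p. if z = ?z then f (fst z) else \<zero>\<^bsub>K\<^esub>)"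
          unfolding mult_app
        proof (rule K.finsum_cong'[OF refl])
          fix z assume "z \<in> factorizations Q p"
          then obtain q r where qr: "z = (q, r)" "r \<in> paths Q" "source q = target Q r" "q \<diamondop> r = p"
            by (auto simp: factorizations_def)
          have "snd r = [] \<longleftrightarrow> z = ?z"
            using qr by (cases q; cases r) (auto simp: concat_path_def tgt)
          then show "f (fst z) \<otimes>\<^bsub>K\<^esub> \<one>\<^bsub>?A\<^esub> (snd z) = (if z = ?z then f (fst z) else \<zero>\<^bsub>K\<^esub>)"
            using qr by (simp add: one_app)
        qed simp
        also have "\<dots> = f p"
          using True ends[OF True] finite_factorizations[of Q p]
          by (subst K.add.finprod_singleton_swap)
            (simp_all add: factorizations_def concat_path_def triv tgt)
        finally show ?thesis .
      qed (simp add: z z' mult_app)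
    qed
  qed
  have fin: "finite {p. f p \<noteq> \<zero>\<^bsub>K\<^esub>}" if "f \<in> carrier ?A" for f
    using that by (simp add: path_algebra_def)
  have carrI: "f \<in> carrier ?A"
    if "\<And>p. f p \<in> carrier K" "\<And>p. p \<notin> paths Q \<Longrightarrow> f p = \<zero>\<^bsub>K\<^esub>" "finite {p. f p \<noteq> \<zero>\<^bsub>K\<^esub>}" for f
    using that by (simp add: path_algebra_def del: split_paired_All)
  have outside: "f p = \<zero>\<^bsub>K\<^esub>" if "f \<in> carrier ?A" "p \<notin> paths Q" for f p
    using that by (simp add: path_algebra_def del: split_paired_All)
  show ?thesis
  proof (rule ringI)
    show "abelian_group ?A"
    proof (rule abelian_groupI)
      fix f g assume fg: "f \<in> carrier ?A" "g \<in> carrier ?A"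
      show "f \<oplus>\<^bsub>?A\<^esub> g \<in> carrier ?A"
      proof (rule carrI)
        have "finite ({p. f p \<noteq> \<zero>\<^bsub>K\<^esub>} \<union> {p. g p \<noteq> \<zero>\<^bsub>K\<^esub>})" using fg[THEN fin] by simp
        then show "finite {p. (f \<oplus>\<^bsub>?A\<^esub> g) p \<noteq> \<zero>\<^bsub>K\<^esub>}"
          by (rule rev_finite_subset) (auto simp: add_app)
      qed (use fg in \<open>simp_all add: add_app carr outside\<close>)
    next
      show "\<zero>\<^bsub>?A\<^esub> \<in> carrier ?A" by (rule carrI) (simp_all add: zero_app)
    next
      fix f assume f: "f \<in> carrier ?A"
      let ?g = "\<lambda>p. \<ominus>\<^bsub>K\<^esub> f p"
      have "?g \<in> carrier ?A"
      proof (rule carrI)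
        show "finite {p. ?g p \<noteq> \<zero>\<^bsub>K\<^esub>}"
          by (rule rev_finite_subset[OF fin[OF f]]) auto
      qed (use f in \<open>simp_all add: carr outside\<close>)
      moreover have "?g \<oplus>\<^bsub>?A\<^esub> f = \<zero>\<^bsub>?A\<^esub>"
        by (rule ext) (simp only: add_app zero_app K.l_neg carr[OF f])
      ultimately show "\<exists>g \<in> carrier ?A. g \<oplus>\<^bsub>?A\<^esub> f = \<zero>\<^bsub>?A\<^esub>" by blast
    next
      fix f assume f: "f \<in> carrier ?A"
      show "\<zero>\<^bsub>?A\<^esub> \<oplus>\<^bsub>?A\<^esub> f = f"
        by (rule ext) (simp only: add_app zero_app K.l_zero carr[OF f])
    next
      fix f g h assume "f \<in> carrier ?A" "g \<in> carrier ?A" "h \<in> carrier ?A"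
      note c = this[THEN carr]
      show "(f \<oplus>\<^bsub>?A\<^esub> g) \<oplus>\<^bsub>?A\<^esub> h = f \<oplus>\<^bsub>?A\<^esub> (g \<oplus>\<^bsub>?A\<^esub> h)"
        by (rule ext) (simp only: add_app K.a_assoc c)
    next
      fix f g assume "f \<in> carrier ?A" "g \<in> carrier ?A"
      note c = this[THEN carr]
      show "f \<oplus>\<^bsub>?A\<^esub> g = g \<oplus>\<^bsub>?A\<^esub> f"
        by (rule ext) (simp only: add_app K.a_comm c)
    qed
    show "monoid ?A"
      by (rule monoidI; (rule mult_closed assoc one_closed one_l one_r; assumption?))
  next
    fix f g h assume "f \<in> carrier ?A" "g \<in> carrier ?A" "h \<in> carrier ?A"
    note c = this[THEN carr]
    show "(f \<oplus>\<^bsub>?A\<^esub> g) \<otimes>\<^bsub>?A\<^esub> h = f \<otimes>\<^bsub>?A\<^esub> h \<oplus>\<^bsub>?A\<^esub> g \<otimes>\<^bsub>?A\<^esub> h"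
      by (rule ext) (simp add: add_app mult_app c K.l_distr K.finsum_addf Pi_def)
    show "h \<otimes>\<^bsub>?A\<^esub> (f \<oplus>\<^bsub>?A\<^esub> g) = h \<otimes>\<^bsub>?A\<^esub> f \<oplus>\<^bsub>?A\<^esub> h \<otimes>\<^bsub>?A\<^esub> g"
      by (rule ext) (simp add: add_app mult_app c K.r_distr K.finsum_addf Pi_def)
  qed
qed


subsection \<open>Quadratic monomial algebras\<close>

definition arrow_ideal :: "('k, 'm) ring_scheme \<Rightarrow> ('v, 'a) pre_digraph
    \<Rightarrow> (('v, 'a) qpath \<Rightarrow> 'k) set"
  where "arrow_ideal K Q = Idl\<^bsub>path_algebra K Q\<^esub> ((\<lambda>\<alpha>. path_elem K (arrow_path Q \<alpha>)) ` arcs Q)"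

text \<open>
  In \<^const>\<open>ideals_set\<close> the multiplication is the product of ideals, so \<open>J [^] d\<close> is the
  \<open>d\<close>-th power of the ideal \<open>J\<close>.
\<close>

definition admissible_ideal :: "('k, 'm) ring_scheme \<Rightarrow> ('v, 'a) pre_digraph
    \<Rightarrow> (('v, 'a) qpath \<Rightarrow> 'k) set \<Rightarrow> bool"
  where "admissible_ideal K Q I \<longleftrightarrow> ideal I (path_algebra K Q) \<and>
    (\<exists>d::nat. 2 \<le> d \<and>
       arrow_ideal K Q [^]\<^bsub>ideals_set (path_algebra K Q)\<^esub> d \<subseteq> I \<and>
       I \<subseteq> arrow_ideal K Q [^]\<^bsub>ideals_set (path_algebra K Q)\<^esub> (2::nat))"

definition quadratic_monomial :: "('k, 'm) ring_scheme \<Rightarrow> ('v, 'a) pre_digraph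
    \<Rightarrow> (('v, 'a) qpath \<Rightarrow> 'k) set \<Rightarrow> bool"
  where "quadratic_monomial K Q I \<longleftrightarrow> admissible_ideal K Q I \<and>
    (\<exists>S \<subseteq> {p \<in> paths Q. path_length p = 2}. I = Idl\<^bsub>path_algebra K Q\<^esub> (path_elem K ` S))"

definition zero_paths :: "('k, 'm) ring_scheme \<Rightarrow> ('v, 'a) pre_digraph
    \<Rightarrow> (('v, 'a) qpath \<Rightarrow> 'k) set \<Rightarrow> ('v, 'a) qpath set"
  where "zero_paths K Q I = {p \<in> paths Q. path_elem K p \<in> I}"

definition nonzero_paths :: "('k, 'm) ring_scheme \<Rightarrow> ('v, 'a) pre_digraph
    \<Rightarrow> (('v, 'a) qpath \<Rightarrow> 'k) set \<Rightarrow> ('v, 'a) qpath set"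
  where "nonzero_paths K Q I = {p \<in> paths Q. path_elem K p \<notin> I}"

definition minimal_zero_paths :: "('k, 'm) ring_scheme \<Rightarrow> ('v, 'a) pre_digraph
    \<Rightarrow> (('v, 'a) qpath \<Rightarrow> 'k) set \<Rightarrow> ('v, 'a) qpath set"  (\<open>\<^bold>F\<close>)
  where "\<^bold>F K Q I = {p \<in> zero_paths K Q I. \<nexists>q. subpath Q q p \<and> q \<noteq> p \<and> q \<in> zero_paths K Q I}"


subsection \<open>Perfect pairs and perfect paths\<close>

definition left_minimal :: "('v, 'a) pre_digraph \<Rightarrow> ('v, 'a) qpath set \<Rightarrow> ('v, 'a) qpath set"
  where "left_minimal Q S = {p \<in> S. \<not> (\<exists>q \<in> S. \<exists>p' \<in> paths Q.
    nontrivial p' \<and> source q = target Q p' \<and> p = q \<diamondop> p')}"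

definition right_minimal :: "('v, 'a) pre_digraph \<Rightarrow> ('v, 'a) qpath set \<Rightarrow> ('v, 'a) qpath set"
  where "right_minimal Q S = {p \<in> S. \<not> (\<exists>q \<in> S. \<exists>p' \<in> paths Q.
    nontrivial p' \<and> source p' = target Q q \<and> p = p' \<diamondop> q)}"

definition L_set :: "('k, 'm) ring_scheme \<Rightarrow> ('v, 'a) pre_digraph
    \<Rightarrow> (('v, 'a) qpath \<Rightarrow> 'k) set \<Rightarrow> ('v, 'a) qpath \<Rightarrow> ('v, 'a) qpath set"
  where "L_set K Q I p = right_minimal Q
    {q \<in> nonzero_paths K Q I. source q = target Q p \<and> q \<diamondop> p \<in> zero_paths K Q I}"

definition R_set :: "('k, 'm) ring_scheme \<Rightarrow> ('v, 'a) pre_digraph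
    \<Rightarrow> (('v, 'a) qpath \<Rightarrow> 'k) set \<Rightarrow> ('v, 'a) qpath \<Rightarrow> ('v, 'a) qpath set"
  where "R_set K Q I p = left_minimal Q
    {q \<in> nonzero_paths K Q I. target Q q = source p \<and> p \<diamondop> q \<in> zero_paths K Q I}"

definition perfect_pair :: "('k, 'm) ring_scheme \<Rightarrow> ('v, 'a) pre_digraph
    \<Rightarrow> (('v, 'a) qpath \<Rightarrow> 'k) set \<Rightarrow> ('v, 'a) qpath \<Rightarrow> ('v, 'a) qpath \<Rightarrow> bool"
  where "perfect_pair K Q I p q \<longleftrightarrow>
    p \<in> nonzero_paths K Q I \<and> q \<in> nonzero_paths K Q I \<and>
    nontrivial p \<and> nontrivial q \<and> source p = target Q q \<and> p \<diamondop> q \<in> zero_paths K Q I \<and>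
    (\<forall>q' \<in> nonzero_paths K Q I. target Q q' = source p \<and> p \<diamondop> q' \<in> zero_paths K Q I \<longrightarrow>
       (\<exists>q'' \<in> paths Q. source q = target Q q'' \<and> q' = q \<diamondop> q'')) \<and>
    (\<forall>p' \<in> nonzero_paths K Q I. source p' = target Q q \<and> p' \<diamondop> q \<in> zero_paths K Q I \<longrightarrow>
       (\<exists>p'' \<in> paths Q. source p'' = target Q p \<and> p' = p'' \<diamondop> p))"

definition perfect_path :: "('k, 'm) ring_scheme \<Rightarrow> ('v, 'a) pre_digraph
    \<Rightarrow> (('v, 'a) qpath \<Rightarrow> 'k) set \<Rightarrow> ('v, 'a) qpath \<Rightarrow> bool"
  where "perfect_path K Q I p \<longleftrightarrow> p \<in> nonzero_paths K Q I \<and>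
    (\<exists>(n::nat) (ps :: nat \<Rightarrow> ('v, 'a) qpath). 1 \<le> n \<and> ps 1 = p \<and> ps (n + 1) = p \<and>
       (\<forall>i \<in> {1..n}. perfect_pair K Q I (ps i) (ps (i + 1))))"


subsection \<open>The relation quiver\<close>

text \<open>The arrow \<open>[\<beta>\<alpha>] : \<alpha> \<rightarrow> \<beta>\<close> of the relation quiver is the pair \<open>(\<beta>, \<alpha>)\<close>.\<close>

definition relation_quiver :: "('k, 'm) ring_scheme \<Rightarrow> ('v, 'a) pre_digraph
    \<Rightarrow> (('v, 'a) qpath \<Rightarrow> 'k) set \<Rightarrow> ('a, 'a \<times> 'a) pre_digraph"
  where "relation_quiver K Q I =
    \<lparr>verts = arcs Q,
     arcs = {(\<beta>, \<alpha>). \<beta> \<in> arcs Q \<and> \<alpha> \<in> arcs Q \<and> head Q \<alpha> = tail Q \<beta> \<and>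
                     arrow_path Q \<beta> \<diamondop> arrow_path Q \<alpha> \<in> zero_paths K Q I},
     tail = snd,
     head = fst\<rparr>"

definition basic_cycle :: "nat \<Rightarrow> ('v, 'a) pre_digraph \<Rightarrow> bool"
  where "basic_cycle n C \<longleftrightarrow> wf_digraph C \<and> 1 \<le> n \<and> card (verts C) = n \<and> card (arcs C) = n \<and>
    (\<exists>c. pre_digraph.cycle C c \<and> set c = arcs C)"

text \<open>
  Connected components are the maximal connected subquivers, connectedness being that of the
  underlying undirected graph.
\<close>

definition perfect_component :: "('k, 'm) ring_scheme \<Rightarrow> ('v, 'a) pre_digraph
    \<Rightarrow> (('v, 'a) qpath \<Rightarrow> 'k) set \<Rightarrow> ('a, 'a \<times> 'a) pre_digraph \<Rightarrow> bool"
  where "perfect_component K Q I C \<longleftrightarrow>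
    pre_digraph.max_subgraph (relation_quiver K Q I) Digraph_Component.connected C \<and>
    (\<exists>n. basic_cycle n C)"

end

theory Submission
  imports Defs
begin

text \<open>
  The ideal \<open>I\<close> is generated by paths of length two, so a path lies in \<open>I\<close> iff two of its
  consecutive arrows \<open>\<alpha>\<close>, \<open>\<beta>\<close> satisfy \<open>\<beta>\<alpha> \<in> I\<close>, that is, form an arrow of the relation quiver
  (\<open>zero_path_iff\<close>). Consequently, when a nonzero path is multiplied by an arrow, only the arrow
  adjacent to it decides whether the product vanishes. This makes everything local: the minimal
  annihilators of an arrow are single arrows (\<open>L_set_arrow\<close>, \<open>R_set_arrow\<close>), and \<open>(\<alpha>, \<beta>)\<close> is a perfect
  pair iff the arrow \<open>\<beta> \<rightarrow> \<alpha>\<close> of the relation quiver shares neither its tail nor its head with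
  another arrow (\<open>perfect_pair_arrows_iff\<close>); such an arrow is called exclusive below.

  For perfect paths, the perfect partner of an arrow is again an arrow, hence a cyclic chain of
  perfect pairs through \<open>\<alpha>\<close> is a closed walk at \<open>\<alpha>\<close>, traversed backwards, consisting of
  exclusive arrows (\<open>perfect_chain_iff_exclusive_awalk\<close>). What remains is a fact on digraphs:
  a vertex lies on a nonempty closed walk of exclusive arcs iff its connected component is a basic
  cycle. Such a walk cannot be left, so it exhausts a component, and after removal of repetitions it
  is a cycle (\<open>exclusive_closed_awalk_component\<close>); conversely, all arcs of a component that is a
  basic cycle are exclusive (\<open>basic_cycle_component_awalk\<close>).
\<close>

section \<open>Basic cycles as components of a digraph\<close>

definition exclusive_arc :: "('v, 'a) pre_digraph \<Rightarrow> 'a \<Rightarrow> bool"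
  where "exclusive_arc G e \<longleftrightarrow>
    e \<in> arcs G \<and> out_arcs G (tail G e) = {e} \<and> in_arcs G (head G e) = {e}"

lemma exclusive_arc_iff:
  "exclusive_arc G e \<longleftrightarrow>
    e \<in> arcs G \<and> (\<forall>e' \<in> arcs G. tail G e' = tail G e \<or> head G e' = head G e \<longrightarrow> e' = e)"
  unfolding exclusive_arc_def out_arcs_def in_arcs_def by blast

lemma exclusive_arc_unique:
  assumes "exclusive_arc G e" "e' \<in> arcs G" "tail G e' = tail G e \<or> head G e' = head G e"
  shows "e' = e"
  using assms unfolding exclusive_arc_iff by blast

context wf_digraph
begin

text \<open>
  Cutting out the part of the walk between two occurrences of the same arc leaves a shorter
  closed walk through the same base point.
\<close>

lemma closed_awalk_distinct:
  assumes "awalk u p u" "p \<noteq> []"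
  obtains q where "awalk u q u" "q \<noteq> []" "set q \<subseteq> set p" "distinct q"
  using assms
proof (induction "length p" arbitrary: p thesis rule: less_induct)
  case less
  show ?case
  proof (cases "distinct p")
    case True
    then show ?thesis using less.prems by blast
  next
    case False
    then obtain xs e ys zs where p: "p = xs @ [e] @ ys @ [e] @ zs"
      using not_distinct_decomp by blast
    let ?q = "xs @ [e] @ zs"
    have "awalk u ?q u"
      using less.prems(2) by (auto simp: p awalk_Cons_iff)
    moreover have "length ?q < length p" "?q \<noteq> []" "set ?q \<subseteq> set p"
      by (auto simp: p)
    ultimately obtain q where "awalk u q u" "q \<noteq> []" "set q \<subseteq> set ?q" "distinct q"
      using less.hyps[of ?q] by metis
    then show ?thesis using less.prems(1) \<open>set ?q \<subseteq> set p\<close> by blast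
  qed
qed

text \<open>
  Since the arcs of the walk are exclusive, no further arc of the digraph meets its vertices, so
  the walk already fills its connected component; and a repeated vertex would be a repeated arc,
  so after shortening the walk is a cycle.
\<close>

lemma exclusive_closed_awalk_component:
  assumes walk: "awalk u p u" "p \<noteq> []" and excl: "\<And>e. e \<in> set p \<Longrightarrow> exclusive_arc G e"
  shows "\<exists>C. max_subgraph connected C \<and> (\<exists>n. basic_cycle n C) \<and> u \<in> verts C"
proof -
  obtain q where q: "awalk u q u" "q \<noteq> []" "distinct q" and "set q \<subseteq> set p"
    using closed_awalk_distinct[OF walk] .
  then have ex: "exclusive_arc G e" if "e \<in> set q" for e
    using that excl by blast
  have qarcs: "set q \<subseteq> arcs G" using q(1) by blast
  have inj: "inj_on (head G) (set q)"
    using ex qarcs by (metis exclusive_arc_unique inj_onI subsetD)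
  have vq: "awalk_verts u q = u # map (head G) q"
    using q awalk_verts_conv'[of u q u] by (cases q) (auto simp: awalk_Cons_iff)
  have last: "head G (last q) = u"
    using q(1,2) vq by (metis awalkE' last_ConsR last_map map_is_Nil_conv)
  let ?V = "head G ` set q"
  have uV: "u \<in> ?V" using last q(2) by force
  have vV: "set (awalk_verts u q) = ?V" using uV by (auto simp: vq)
  have tailV: "tail G ` set q \<subseteq> ?V"
    using awalk_verts_arc1[of _ q u] vV by blast
  have headV: "v \<in> ?V \<Longrightarrow> \<exists>e \<in> set q. tail G e = v" for v
  proof -
    assume "v \<in> ?V"
    then have "v \<in> set (map (tail G) q @ [head G (last q)])"
      using vV q(2) by (simp add: awalk_verts_conv)
    then show ?thesis using last q by (cases q) (auto simp: awalk_Cons_iff)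
  qed
  \<comment> \<open>No arc of the digraph joins a vertex on the walk to anything off the walk.\<close>
  have closed: "e \<in> set q" if "e \<in> arcs G" "tail G e \<in> ?V \<or> head G e \<in> ?V" for e
    using that headV ex exclusive_arc_unique[of G _ e] by (metis image_iff)
  define C where "C = \<lparr>verts = ?V, arcs = set q, tail = tail G, head = head G\<rparr>"
  have C [simp]: "verts C = ?V" "arcs C = set q" "tail C = tail G" "head C = head G"
    by (simp_all add: C_def)
  interpret C: wf_digraph C
    using tailV by unfold_locales auto
  have sub: "subgraph C G"
    using qarcs by (auto simp: subgraph_def compatible_def wf_digraph C.wf_digraph)
  have walkC: "C.awalk u q u"
    using q(1) uV sub by (auto simp: C.awalk_def awalk_def compatible_cas[of G C] elim!: subgraphE)
  have vC: "C.awalk_verts u q = awalk_verts u q"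
    using sub compatible_awalk_verts[of G C] by (auto elim!: subgraphE)
  have "strongly_connected C"
  proof
    show "verts C \<noteq> {}" using uV by auto
    fix v w assume "v \<in> verts C" "w \<in> verts C"
    then have "v \<rightarrow>\<^sup>*\<^bsub>C\<^esub> u" "u \<rightarrow>\<^sup>*\<^bsub>C\<^esub> w"
      using C.awalk_verts_reachable_to[OF walkC] C.awalk_verts_reachable_from[OF walkC]
      by (simp_all add: vC vV)
    then show "v \<rightarrow>\<^sup>*\<^bsub>C\<^esub> w" by (rule C.reachable_trans)
  qed
  then have conn: "connected C"
    unfolding connected_def strongly_connected_def
    using C.reachable_mk_symmetricI by simp
  have "max_subgraph connected C"
  proof (rule max_subgraphI[where P = connected and x = C, OF conn sub])
    fix H assume H: "C \<noteq> H" "subgraph C H" "subgraph H G"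
    interpret H: wf_digraph H using H(3) by blast
    have ends: "tail H = tail G" "head H = head G"
      using H(3) by (auto simp: subgraph_def compatible_def)
    have sub': "arcs C \<subseteq> arcs H" "verts C \<subseteq> verts H" "arcs H \<subseteq> arcs G"
      using H by (auto simp: subgraph_def)
    show "\<not> connected H"
    proof
      assume "connected H"
      have "v \<in> ?V" if "v \<in> verts H" for v
      proof -
        have "(u, v) \<in> rtrancl_on (verts H) ((arcs_ends H)\<^sup>s)"
          using \<open>connected H\<close> that uV sub' unfolding connected_conv by auto
        then show ?thesis
        proof (induction rule: rtrancl_on_induct)
          case base
          show ?case by (fact uV)
        next
          case (step y z)
          have "(y, z) \<in> arcs_ends H \<or> (z, y) \<in> arcs_ends H"
            using step.hyps(2) by (auto simp: symcl_def)
          then obtain e where e: "e \<in> arcs H"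
            "tail G e = y \<and> head G e = z \<or> head G e = y \<and> tail G e = z"
            by (auto simp: arcs_ends_conv ends)
          then have "e \<in> set q"
            using step.IH closed[of e] sub' by blast
          then show ?case using e(2) tailV by blast
        qed
      qed
      then have V: "verts H = ?V" using sub' by auto
      then have "arcs H = set q"
        using sub' closed H.head_in_verts by (auto simp: ends)
      then have "C = H"
        using V ends by (intro pre_digraph.equality) auto
      then show False using H(1) by simp
    qed
  qed
  moreover have "basic_cycle (length q) C"
    unfolding basic_cycle_def
  proof (intro conjI exI)
    show "card (verts C) = length q" "card (arcs C) = length q"
      using inj q(3) by (simp_all add: card_image distinct_card)
    show "C.cycle q"
      using walkC q inj unfolding C.cycle_def
      by (intro exI[of _ u]) (simp add: vC vq distinct_map)
  qed (use q(2) in \<open>auto simp: C.wf_digraph Suc_le_eq\<close>)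
  ultimately show ?thesis using uV by auto
qed

text \<open>Adding such an arc and its endpoints to \<open>C\<close> keeps it connected, against maximality.\<close>

lemma max_connected_closed:
  assumes max: "max_subgraph connected C" and e: "e \<in> arcs G"
    and meets: "tail G e \<in> verts C \<or> head G e \<in> verts C"
  shows "e \<in> arcs C"
proof -
  have sub: "subgraph C G" and conn: "connected C"
    using max by (auto simp: max_subgraph_def)
  have ends: "tail C = tail G" "head C = head G"
    using sub by (auto simp: subgraph_def compatible_def)
  interpret C: wf_digraph C using sub by blast
  define H where "H = \<lparr>verts = verts C \<union> {tail G e, head G e}, arcs = insert e (arcs C),
    tail = tail G, head = head G\<rparr>"
  have H [simp]: "verts H = verts C \<union> {tail G e, head G e}" "arcs H = insert e (arcs C)"
    "tail H = tail G" "head H = head G"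
    by (simp_all add: H_def)
  interpret H: wf_digraph H
    using C.head_in_verts C.tail_in_verts by unfold_locales (auto simp: ends)
  have subs: "subgraph C H" "subgraph H G"
    using sub e tail_in_verts[OF e] head_in_verts[OF e]
    by (auto simp: subgraph_def compatible_def H.wf_digraph)
  let ?R = "rtrancl_on (verts H) ((arcs_ends H)\<^sup>s)"
  have old: "(u, v) \<in> ?R" if "u \<in> verts C" "v \<in> verts C" for u v
  proof -
    have "(u, v) \<in> rtrancl_on (verts C) ((arcs_ends C)\<^sup>s)"
      using conn that unfolding connected_conv by auto
    then show ?thesis
      by (rule rtrancl_on_mono[rotated -1]) (auto simp: symcl_def arcs_ends_conv ends)
  qed
  have new: "(tail G e, head G e) \<in> ?R" "(head G e, tail G e) \<in> ?R"
    by (rule rtrancl_on_into_rtrancl_on[OF rtrancl_on_refl];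
        force simp: symcl_def arcs_ends_conv)+
  obtain w where w: "w \<in> verts C" "w \<in> {tail G e, head G e}"
    using meets by auto
  have "(w, v) \<in> ?R" "(v, w) \<in> ?R" if "v \<in> verts H" for v
    using that w old new by auto
  then have "connected H"
    unfolding connected_conv using w by (auto intro: rtrancl_on_trans)
  then have "H = C" using max subs by (auto simp: max_subgraph_def)
  then show ?thesis using H(2) by auto
qed

end

text \<open>
  The walk is the cycle itself, started at \<open>u\<close>. Inside a basic cycle every vertex has one
  incoming and one outgoing arc, and maximality rules out arcs from elsewhere.
\<close>

lemma (in wf_digraph) basic_cycle_component_awalk:
  assumes max: "max_subgraph connected C" and cyc: "basic_cycle n C" and u: "u \<in> verts C"
  shows "\<exists>p. awalk u p u \<and> p \<noteq> [] \<and> (\<forall>e \<in> set p. exclusive_arc G e)"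
proof -
  have sub: "subgraph C G" using max by (auto simp: max_subgraph_def)
  have ends: "tail C = tail G" "head C = head G"
    using sub by (auto simp: subgraph_def compatible_def)
  interpret C: wf_digraph C using sub by blast
  obtain c where "C.cycle c" and c: "set c = arcs C" and n: "card (verts C) = n" "card (arcs C) = n"
    "1 \<le> n"
    using cyc unfolding basic_cycle_def by blast
  then obtain w where w: "C.awalk w c w" "distinct (tl (C.awalk_verts w c))" "distinct c" "c \<noteq> []"
    unfolding C.cycle_conv by blast
  have verts_w: "C.awalk_verts w c = w # map (head G) c"
    using w C.awalk_verts_conv'[of w c w] by (cases c) (auto simp: C.awalk_Cons_iff ends)
  then have inj_h: "inj_on (head G) (arcs C)"
    using w(2) c by (simp add: distinct_map)
  have "head G ` arcs C = verts C"
  proof (rule card_subset_eq)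
    show "finite (verts C)" using n by (auto intro: card_ge_0_finite)
    show "head G ` arcs C \<subseteq> verts C" using C.head_in_verts by (auto simp: ends)
    show "card (head G ` arcs C) = card (verts C)" using inj_h n by (simp add: card_image)
  qed
  then have verts_c: "set (C.awalk_verts w c) = verts C"
    using C.awalk_hd_in_verts[OF w(1)] c by (auto simp: verts_w)
  \<comment> \<open>Moving the base point from the end of the list of vertices to its front turns the heads
    of the arcs into their tails.\<close>
  have "map (tail G) c @ [head G (last c)] = w # map (head G) c"
    using verts_w w(4) by (simp add: C.awalk_verts_conv ends)
  moreover have "head G (last c) = w"
    using w(1,4) verts_w by (metis C.awalkE' last_ConsR last_map map_is_Nil_conv)
  ultimately have "mset (map (tail G) c) = mset (map (head G) c)"
    by (metis add_mset_add_single mset.simps(2) mset_append add_right_cancel mset.simps(1))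
  then have "distinct (map (tail G) c)"
    using w(2) verts_w by (metis list.sel(3) mset_eq_imp_distinct_iff)
  then have inj_t: "inj_on (tail G) (arcs C)"
    using c by (simp add: distinct_map)
  have excl: "exclusive_arc G e" if e: "e \<in> arcs C" for e
  proof -
    have eG: "e \<in> arcs G" using e sub by blast
    have "tail G e \<in> verts C" "head G e \<in> verts C"
      using e C.tail_in_verts C.head_in_verts by (auto simp: ends)
    then have "e' = e" if "e' \<in> arcs G" "tail G e' = tail G e \<or> head G e' = head G e" for e'
      using that max_connected_closed[OF max that(1)] e inj_h inj_t by (metis inj_onD)
    then show ?thesis using eG unfolding exclusive_arc_iff by blast
  qed
  obtain q r where qr: "c = q @ r" "C.awalk w q u" "C.awalk u r w"
    using C.awalk_decomp[OF w(1)] verts_c u by blast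
  then have "C.awalk u (r @ q) u" by (metis C.awalk_appendI)
  then have "awalk u (r @ q) u" using sub by (rule subgraph_awalk_imp_awalk)
  moreover have "r @ q \<noteq> []" "\<forall>e \<in> set (r @ q). exclusive_arc G e"
    using qr(1) w(4) excl c by auto
  ultimately show ?thesis by blast
qed


section \<open>Paths in the path algebra\<close>

context
  fixes K :: "('k, 'm) ring_scheme" and Q :: "('v, 'a) pre_digraph"
  assumes K: "field K" and Q: "fin_digraph Q"
begin

interpretation K: field K by (fact K)
interpretation A: ring "path_algebra K Q" by (rule ring_path_algebra[OF K Q])

lemma path_elem_carrier: "p \<in> paths Q \<Longrightarrow> path_elem K p \<in> carrier (path_algebra K Q)"
  by (auto simp: path_algebra_def path_elem_def)

lemma path_elem_mult:
  assumes "q \<in> paths Q" "r \<in> paths Q" "source q = target Q r"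
  shows "path_elem K q \<otimes>\<^bsub>path_algebra K Q\<^esub> path_elem K r = path_elem K (q \<diamondop> r)"
proof
  fix p
  let ?D = "factorizations Q p"
  have "(path_elem K q \<otimes>\<^bsub>path_algebra K Q\<^esub> path_elem K r) p
      = (\<Oplus>\<^bsub>K\<^esub>z\<in>?D. if z = (q, r) then \<one>\<^bsub>K\<^esub> else \<zero>\<^bsub>K\<^esub>)"
    unfolding path_algebra_def by (auto simp: path_elem_def intro!: K.finsum_cong')
  also have "\<dots> = path_elem K (q \<diamondop> r) p"
  proof (cases "q \<diamondop> r = p")
    case True
    then have "(q, r) \<in> ?D" using assms by (simp add: factorizations_def)
    then show ?thesis
      using True finite_factorizations[of Q p]
      by (subst K.add.finprod_singleton_swap) (simp_all add: path_elem_def)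
  next
    case False
    then have "(q, r) \<notin> ?D" by (simp add: factorizations_def)
    then have "(if z = (q, r) then \<one>\<^bsub>K\<^esub> else \<zero>\<^bsub>K\<^esub>) = \<zero>\<^bsub>K\<^esub>" if "z \<in> ?D" for z
      using that by auto
    then have "(\<Oplus>\<^bsub>K\<^esub>z\<in>?D. if z = (q, r) then \<one>\<^bsub>K\<^esub> else \<zero>\<^bsub>K\<^esub>) = \<zero>\<^bsub>K\<^esub>"
      by (rule K.add.finprod_one_eqI)
    then show ?thesis using False by (auto simp: path_elem_def)
  qed
  finally show "(path_elem K q \<otimes>\<^bsub>path_algebra K Q\<^esub> path_elem K r) p = path_elem K (q \<diamondop> r) p" .
qed

text \<open>
  A product of two elements is supported on concatenations of paths from the two supports, so a
  condition on paths that passes to every concatenation cuts out a two-sided ideal.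
\<close>

lemma ideal_supported:
  assumes "\<And>q r. source q = target Q r \<Longrightarrow> P q \<or> P r \<Longrightarrow> P (q \<diamondop> r)"
  shows "ideal {f \<in> carrier (path_algebra K Q). \<forall>p. f p \<noteq> \<zero>\<^bsub>K\<^esub> \<longrightarrow> P p} (path_algebra K Q)"
    (is "ideal ?M ?A")
proof (rule idealI)
  show "ring ?A" by (fact A.ring_axioms)
  have carr: "f p \<in> carrier K" if "f \<in> carrier ?A" for f p
    using that by (cases p; cases "p \<in> paths Q") (auto simp: path_algebra_def)
  have add_app: "(g \<oplus>\<^bsub>?A\<^esub> h) p = g p \<oplus>\<^bsub>K\<^esub> h p" and zero_app: "\<zero>\<^bsub>?A\<^esub> p = \<zero>\<^bsub>K\<^esub>" for g h p
    by (simp_all add: path_algebra_def)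
  have mult: "\<exists>q r. source q = target Q r \<and> q \<diamondop> r = p \<and> f q \<noteq> \<zero>\<^bsub>K\<^esub> \<and> g r \<noteq> \<zero>\<^bsub>K\<^esub>"
    if "f \<in> carrier ?A" "g \<in> carrier ?A" "(f \<otimes>\<^bsub>?A\<^esub> g) p \<noteq> \<zero>\<^bsub>K\<^esub>" for f g p
  proof (rule ccontr)
    assume "\<not> ?thesis"
    then have "f (fst z) = \<zero>\<^bsub>K\<^esub> \<or> g (snd z) = \<zero>\<^bsub>K\<^esub>" if "z \<in> factorizations Q p" for z
      using that by (force simp: factorizations_def)
    then have "f (fst z) \<otimes>\<^bsub>K\<^esub> g (snd z) = \<zero>\<^bsub>K\<^esub>" if "z \<in> factorizations Q p" for z
      using that K.l_null[OF carr] K.r_null[OF carr] \<open>f \<in> carrier ?A\<close> \<open>g \<in> carrier ?A\<close> by metis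
    then have "(f \<otimes>\<^bsub>?A\<^esub> g) p = \<zero>\<^bsub>K\<^esub>"
      by (auto simp: path_algebra_def intro!: K.add.finprod_one_eqI)
    then show False using that(3) by simp
  qed
  have MI: "f \<in> ?M" if "f \<in> carrier ?A" "\<And>p. f p \<noteq> \<zero>\<^bsub>K\<^esub> \<Longrightarrow> P p" for f
    using that by blast
  have MD: "f \<in> carrier ?A" "\<And>p. f p \<noteq> \<zero>\<^bsub>K\<^esub> \<Longrightarrow> P p" if "f \<in> ?M" for f
    using that by blast+
  show "subgroup ?M (add_monoid ?A)"
  proof (rule A.add.subgroupI)
    show "?M \<subseteq> carrier ?A" by blast
    have "\<zero>\<^bsub>?A\<^esub> \<in> ?M" by (rule MI[OF A.zero_closed]) (simp add: zero_app)
    then show "?M \<noteq> {}" by blast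
  next
    fix f assume f: "f \<in> ?M"
    have neg: "\<ominus>\<^bsub>?A\<^esub> f \<in> carrier ?A" by (rule A.a_inv_closed[OF MD(1)[OF f]])
    have "\<ominus>\<^bsub>?A\<^esub> f \<oplus>\<^bsub>?A\<^esub> f = \<zero>\<^bsub>?A\<^esub>" by (rule A.l_neg[OF MD(1)[OF f]])
    then have sum0: "(\<ominus>\<^bsub>?A\<^esub> f) p \<oplus>\<^bsub>K\<^esub> f p = \<zero>\<^bsub>K\<^esub>" for p
      using add_app[of "\<ominus>\<^bsub>?A\<^esub> f" f p] zero_app[of p] by simp
    have "f p \<noteq> \<zero>\<^bsub>K\<^esub>" if "(\<ominus>\<^bsub>?A\<^esub> f) p \<noteq> \<zero>\<^bsub>K\<^esub>" for p
      using that sum0[of p] carr[OF neg, of p] by auto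
    then show "\<ominus>\<^bsub>?A\<^esub> f \<in> ?M" by (intro MI[OF neg] MD(2)[OF f])
  next
    fix f g assume fg: "f \<in> ?M" "g \<in> ?M"
    show "f \<oplus>\<^bsub>?A\<^esub> g \<in> ?M"
    proof (rule MI)
      show "f \<oplus>\<^bsub>?A\<^esub> g \<in> carrier ?A" by (rule A.a_closed[OF fg[THEN MD(1)]])
      fix p assume "(f \<oplus>\<^bsub>?A\<^esub> g) p \<noteq> \<zero>\<^bsub>K\<^esub>"
      then have "f p \<noteq> \<zero>\<^bsub>K\<^esub> \<or> g p \<noteq> \<zero>\<^bsub>K\<^esub>" by (auto simp: add_app)
      then show "P p" using fg[THEN MD(2)] by blast
    qed
  qed
  fix f g assume f: "f \<in> ?M" and g: "g \<in> carrier ?A"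
  then have fc: "f \<in> carrier ?A" by blast
  have "P p" if "(g \<otimes>\<^bsub>?A\<^esub> f) p \<noteq> \<zero>\<^bsub>K\<^esub>" for p
    using mult[OF g fc that] f assms by blast
  then show "g \<otimes>\<^bsub>?A\<^esub> f \<in> ?M" using A.m_closed[OF g fc] by blast
  have "P p" if "(f \<otimes>\<^bsub>?A\<^esub> g) p \<noteq> \<zero>\<^bsub>K\<^esub>" for p
    using mult[OF fc g that] f assms by blast
  then show "f \<otimes>\<^bsub>?A\<^esub> g \<in> ?M" using A.m_closed[OF fc g] by blast
qed

end


section \<open>Zero paths of a quadratic monomial algebra\<close>

lemma not_successively_split:
  "\<not> successively P xs \<Longrightarrow> \<exists>us a b ws. xs = us @ [a, b] @ ws \<and> \<not> P a b"
proof (induction P xs rule: successively.induct)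
  case (3 P x y xs)
  show ?case
  proof (cases "P x y")
    case True
    then obtain us a b ws where "y # xs = us @ [a, b] @ ws" "\<not> P a b"
      using 3 by auto
    then show ?thesis by (intro exI[of _ "x # us"]) auto
  next
    case False
    then show ?thesis by (intro exI[of _ "[]"]) auto
  qed
qed auto

locale quadratic_monomial_quiver = fin_digraph Q
  for K :: "('k, 'm) ring_scheme" and Q :: "('v, 'a) pre_digraph" +
  fixes I :: "(('v, 'a) qpath \<Rightarrow> 'k) set"
  assumes field_K: "field K" and quadratic: "quadratic_monomial K Q I"
begin

abbreviation "R \<equiv> relation_quiver K Q I"

lemma target_simps [simp]:
  "target Q (v, []) = v" "target Q (v, \<gamma> # xs) = target Q (head Q \<gamma>, xs)"
  "target Q (v, xs @ [\<gamma>]) = head Q \<gamma>" "target Q (arrow_path Q \<gamma>) = head Q \<gamma>"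
  by (simp_all add: target_def arrow_path_def awalk_verts_conv)

lemma source_arrow_path [simp]: "source (arrow_path Q \<gamma>) = tail Q \<gamma>"
  by (simp add: arrow_path_def)

lemma paths_Cons_iff:
  "(v, \<gamma> # xs) \<in> paths Q \<longleftrightarrow> \<gamma> \<in> arcs Q \<and> v = tail Q \<gamma> \<and> (head Q \<gamma>, xs) \<in> paths Q"
  by (simp add: paths_def awalk_Cons_iff)

lemma paths_append_iff:
  "(v, xs @ ys) \<in> paths Q \<longleftrightarrow> (v, xs) \<in> paths Q \<and> (target Q (v, xs), ys) \<in> paths Q"
  by (simp add: paths_def target_def awlast_append)

lemma paths_Nil_iff: "(v, []) \<in> paths Q \<longleftrightarrow> v \<in> verts Q"
  by (simp add: paths_def awalk_Nil_iff)

lemma arrow_path_in_paths: "\<gamma> \<in> arcs Q \<Longrightarrow> arrow_path Q \<gamma> \<in> paths Q"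
  by (simp add: arrow_path_def paths_Cons_iff paths_Nil_iff)

lemma relation_quiver_simps [simp]:
  "verts R = arcs Q" "tail R = snd" "head R = fst"
  by (simp_all add: relation_quiver_def)

lemma relation_arc_iff:
  "(\<beta>, \<alpha>) \<in> arcs R \<longleftrightarrow> \<beta> \<in> arcs Q \<and> \<alpha> \<in> arcs Q \<and> head Q \<alpha> = tail Q \<beta> \<and>
    (tail Q \<alpha>, [\<alpha>, \<beta>]) \<in> zero_paths K Q I"
  by (simp add: relation_quiver_def arrow_path_def concat_path_def)

text \<open>
  The elements supported on paths that run through a generator form an ideal, so every path in
  \<open>I\<close> runs through a generator; conversely \<open>I\<close> absorbs the two remaining pieces of such a path.
\<close>

lemma zero_path_iff:
  assumes p: "p \<in> paths Q"
  shows "p \<in> zero_paths K Q I \<longleftrightarrow> \<not> successively (\<lambda>\<alpha> \<beta>. (\<beta>, \<alpha>) \<notin> arcs R) (snd p)"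
proof -
  interpret K: field K by (fact field_K)
  interpret A: ring "path_algebra K Q" by (rule ring_path_algebra[OF field_K fin_digraph])
  obtain S where S: "S \<subseteq> {p \<in> paths Q. path_length p = 2}"
    and I: "I = Idl\<^bsub>path_algebra K Q\<^esub> (path_elem K ` S)"
    using quadratic unfolding quadratic_monomial_def by blast
  interpret I: ideal I "path_algebra K Q"
    using quadratic unfolding quadratic_monomial_def admissible_ideal_def by blast
  note elem = path_elem_carrier[OF field_K fin_digraph]
  have gens: "path_elem K ` S \<subseteq> carrier (path_algebra K Q)"
    using S elem by blast
  show ?thesis
  proof
    assume "p \<in> zero_paths K Q I"
    then have pI: "path_elem K p \<in> I" by (simp add: zero_paths_def)
    define P where "P q \<longleftrightarrow> (\<exists>s \<in> S. \<exists>us ws. snd q = us @ snd s @ ws)" for q :: "('v, 'a) qpath"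
    have "P (q \<diamondop> r)" if "P q \<or> P r" for q r
      using that
    proof
      assume "P q"
      then obtain s us ws where "s \<in> S" "snd q = us @ snd s @ ws" unfolding P_def by blast
      then have "snd (q \<diamondop> r) = (snd r @ us) @ snd s @ ws" by (simp add: concat_path_def)
      then show ?thesis using \<open>s \<in> S\<close> unfolding P_def by blast
    next
      assume "P r"
      then obtain s us ws where "s \<in> S" "snd r = us @ snd s @ ws" unfolding P_def by blast
      then have "snd (q \<diamondop> r) = us @ snd s @ (ws @ snd q)" by (simp add: concat_path_def)
      then show ?thesis using \<open>s \<in> S\<close> unfolding P_def by blast
    qed
    then have "ideal {f \<in> carrier (path_algebra K Q). \<forall>p. f p \<noteq> \<zero>\<^bsub>K\<^esub> \<longrightarrow> P p} (path_algebra K Q)"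
      (is "ideal ?M _")
      by (intro ideal_supported[OF field_K fin_digraph])
    moreover have "path_elem K s \<in> ?M" if "s \<in> S" for s
    proof -
      have "snd s = [] @ snd s @ []" by simp
      then have "P s" using that unfolding P_def by blast
      then have "\<forall>p. path_elem K s p \<noteq> \<zero>\<^bsub>K\<^esub> \<longrightarrow> P p" unfolding path_elem_def by metis
      then show ?thesis using gens that by blast
    qed
    ultimately have "I \<subseteq> ?M" unfolding I by (intro A.genideal_minimal) blast+
    then have "path_elem K p \<in> ?M" using pI by blast
    moreover have "path_elem K p p \<noteq> \<zero>\<^bsub>K\<^esub>" by (simp add: path_elem_def)
    ultimately have "P p" by blast
    then obtain s us ws where s: "s \<in> S" "snd p = us @ snd s @ ws" unfolding P_def by blast
    obtain v a b where ab: "s = (v, [a, b])"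
      using S s(1) by (cases s) (auto simp: numeral_2_eq_2 length_Suc_conv)
    have "s \<in> paths Q" using S s(1) by blast
    moreover have "path_elem K s \<in> I"
      unfolding I using A.genideal_self[OF gens] s(1) by blast
    ultimately have "(b, a) \<in> arcs R"
      by (auto simp: ab relation_arc_iff zero_paths_def paths_Cons_iff)
    then show "\<not> successively (\<lambda>\<alpha> \<beta>. (\<beta>, \<alpha>) \<notin> arcs R) (snd p)"
      by (simp add: s(2) ab successively_append_iff)
  next
    assume "\<not> successively (\<lambda>\<alpha> \<beta>. (\<beta>, \<alpha>) \<notin> arcs R) (snd p)"
    then obtain us a b ws where w: "snd p = us @ [a, b] @ ws" and ab: "(b, a) \<in> arcs R"
      using not_successively_split by blast
    let ?u = "(source p, us)" and ?m = "(tail Q a, [a, b])" and ?w = "(head Q b, ws)"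
    have "(source p, us @ [a, b] @ ws) \<in> paths Q"
      using p w by (metis prod.collapse)
    then have u: "?u \<in> paths Q" "target Q ?u = tail Q a" and m: "?m \<in> paths Q"
      and w': "?w \<in> paths Q"
      by (auto simp: paths_append_iff paths_Cons_iff paths_Nil_iff)
    have mu: "?m \<diamondop> ?u \<in> paths Q" and tmu: "target Q (?m \<diamondop> ?u) = head Q b"
      using paths_concat[OF fin_digraph, of ?m ?u] u m by simp_all
    have "path_elem K ?m \<in> I" using ab by (simp add: relation_arc_iff zero_paths_def)
    then have "path_elem K ?m \<otimes>\<^bsub>path_algebra K Q\<^esub> path_elem K ?u \<in> I"
      using elem[OF u(1)] by (rule I.I_r_closed)
    then have "path_elem K (?m \<diamondop> ?u) \<in> I"
      using path_elem_mult[OF field_K fin_digraph m u(1)] u(2) by simp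
    then have "path_elem K ?w \<otimes>\<^bsub>path_algebra K Q\<^esub> path_elem K (?m \<diamondop> ?u) \<in> I"
      using elem[OF w'] by (rule I.I_l_closed)
    then have "path_elem K (?w \<diamondop> (?m \<diamondop> ?u)) \<in> I"
      using path_elem_mult[OF field_K fin_digraph w' mu] tmu by simp
    moreover have "?w \<diamondop> (?m \<diamondop> ?u) = p"
      using w by (cases p) (simp add: concat_path_def)
    ultimately show "p \<in> zero_paths K Q I" using p by (simp add: zero_paths_def)
  qed
qed

lemma nonzero_path_iff:
  "p \<in> nonzero_paths K Q I \<longleftrightarrow>
    p \<in> paths Q \<and> successively (\<lambda>\<alpha> \<beta>. (\<beta>, \<alpha>) \<notin> arcs R) (snd p)"
  using zero_path_iff[of p] by (auto simp: nonzero_paths_def zero_paths_def)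

lemma arrow_path_nonzero: "\<alpha> \<in> arcs Q \<Longrightarrow> arrow_path Q \<alpha> \<in> nonzero_paths K Q I"
  by (simp add: nonzero_path_iff arrow_path_in_paths) (simp add: arrow_path_def)

text \<open>
  Multiplying a nonzero path by an arrow creates one new pair of consecutive arrows, and only
  that pair can make the product vanish.
\<close>

lemma nonzero_times_arrow_zero_iff:
  assumes q: "q \<in> nonzero_paths K Q I" and \<alpha>: "\<alpha> \<in> arcs Q" and st: "source q = head Q \<alpha>"
  shows "q \<diamondop> arrow_path Q \<alpha> \<in> zero_paths K Q I \<longleftrightarrow> snd q \<noteq> [] \<and> (hd (snd q), \<alpha>) \<in> arcs R"
proof -
  have "q \<diamondop> arrow_path Q \<alpha> \<in> paths Q"
    using q \<alpha> st paths_concat(1)[OF fin_digraph, of q "arrow_path Q \<alpha>"]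
    by (simp add: nonzero_path_iff arrow_path_in_paths)
  moreover have "snd (q \<diamondop> arrow_path Q \<alpha>) = \<alpha> # snd q"
    by (simp add: concat_path_def arrow_path_def)
  ultimately show ?thesis
    using q by (simp add: zero_path_iff nonzero_path_iff successively_Cons)
qed

lemma arrow_times_nonzero_zero_iff:
  assumes q: "q \<in> nonzero_paths K Q I" and \<alpha>: "\<alpha> \<in> arcs Q" and st: "target Q q = tail Q \<alpha>"
  shows "arrow_path Q \<alpha> \<diamondop> q \<in> zero_paths K Q I \<longleftrightarrow> snd q \<noteq> [] \<and> (\<alpha>, last (snd q)) \<in> arcs R"
proof -
  have "arrow_path Q \<alpha> \<diamondop> q \<in> paths Q"
    using q \<alpha> st paths_concat(1)[OF fin_digraph, of "arrow_path Q \<alpha>" q]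
    by (simp add: nonzero_path_iff arrow_path_in_paths)
  moreover have "snd (arrow_path Q \<alpha> \<diamondop> q) = snd q @ [\<alpha>]"
    by (simp add: concat_path_def arrow_path_def)
  ultimately show ?thesis
    using q by (simp add: zero_path_iff nonzero_path_iff successively_append_iff)
qed

lemma arrow_product_zero_iff:
  assumes "\<alpha> \<in> arcs Q" "\<beta> \<in> arcs Q" "head Q \<alpha> = tail Q \<beta>"
  shows "arrow_path Q \<beta> \<diamondop> arrow_path Q \<alpha> \<in> zero_paths K Q I \<longleftrightarrow> (\<beta>, \<alpha>) \<in> arcs R"
  using assms by (simp add: relation_arc_iff arrow_path_def concat_path_def)

text \<open>Every path in \<open>I\<close> has length at least two, so one of length exactly two is minimal.\<close>

lemma arrow_product_minimal_iff:
  assumes "\<alpha> \<in> arcs Q" "\<beta> \<in> arcs Q" "head Q \<alpha> = tail Q \<beta>"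
  shows "arrow_path Q \<beta> \<diamondop> arrow_path Q \<alpha> \<in> \<^bold>F K Q I \<longleftrightarrow> (\<beta>, \<alpha>) \<in> arcs R"
proof -
  have "q = arrow_path Q \<beta> \<diamondop> arrow_path Q \<alpha>"
    if sub: "subpath Q q (arrow_path Q \<beta> \<diamondop> arrow_path Q \<alpha>)" and q: "q \<in> zero_paths K Q I" for q
  proof -
    obtain u v where uv: "source q = target Q v" "arrow_path Q \<beta> \<diamondop> arrow_path Q \<alpha> = u \<diamondop> q \<diamondop> v"
      using sub unfolding subpath_def by blast
    have "q \<in> paths Q" using q by (simp add: zero_paths_def)
    then have "\<not> successively (\<lambda>\<alpha> \<beta>. (\<beta>, \<alpha>) \<notin> arcs R) (snd q)"
      using q zero_path_iff by blast
    then have "2 \<le> length (snd q)"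
      using not_successively_split[of _ "snd q"] by fastforce
    moreover have "[\<alpha>, \<beta>] = snd v @ snd q @ snd u" "source v = tail Q \<alpha>"
      using uv(2) by (simp_all add: concat_path_def arrow_path_def)
    moreover from this have "2 = length (snd v) + length (snd q) + length (snd u)"
      by (metis add.assoc length_append length_Cons list.size(3) numeral_2_eq_2)
    ultimately have "snd v = []" "snd q = [\<alpha>, \<beta>]" "source v = tail Q \<alpha>" by auto
    then show ?thesis
      using uv(1) by (cases v; cases q) (simp add: concat_path_def arrow_path_def)
  qed
  then show ?thesis
    using arrow_product_zero_iff[OF assms] unfolding minimal_zero_paths_def by blast
qed


section \<open>Perfect pairs and perfect paths starting from an arrow\<close>

text \<open>
  A nonzero path annihilates \<open>\<alpha>\<close> from the left exactly when its first arrow does, so the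
  right-minimal ones are single arrows.
\<close>

lemma L_set_arrow:
  assumes \<alpha>: "\<alpha> \<in> arcs Q"
  shows "L_set K Q I (arrow_path Q \<alpha>) = arrow_path Q ` {\<beta> \<in> arcs Q. (\<beta>, \<alpha>) \<in> arcs R}"
    (is "_ = ?B")
proof (intro equalityI subsetI)
  let ?T = "{q \<in> nonzero_paths K Q I. source q = target Q (arrow_path Q \<alpha>) \<and>
    q \<diamondop> arrow_path Q \<alpha> \<in> zero_paths K Q I}"
  have T: "arrow_path Q \<beta> \<in> ?T" if "(\<beta>, \<alpha>) \<in> arcs R" for \<beta>
    using that arrow_path_nonzero arrow_product_zero_iff by (auto simp: relation_arc_iff)
  {
    fix q assume "q \<in> L_set K Q I (arrow_path Q \<alpha>)"
    then have q: "q \<in> ?T" and minimal: "\<And>r p'. r \<in> ?T \<Longrightarrow> p' \<in> paths Q \<Longrightarrow> nontrivial p' \<Longrightarrow>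
        source p' = target Q r \<Longrightarrow> q \<noteq> p' \<diamondop> r"
      unfolding L_set_def right_minimal_def by blast+
    then have "snd q \<noteq> []" "(hd (snd q), \<alpha>) \<in> arcs R"
      using nonzero_times_arrow_zero_iff[of q \<alpha>] \<alpha> by auto
    then obtain v \<beta> xs where qv: "q = (v, \<beta> # xs)" and \<beta>: "(\<beta>, \<alpha>) \<in> arcs R"
      by (cases q; cases "snd q") auto
    have path: "\<beta> \<in> arcs Q" "v = tail Q \<beta>" "(head Q \<beta>, xs) \<in> paths Q"
      using q by (auto simp: qv nonzero_path_iff paths_Cons_iff)
    have "q = (head Q \<beta>, xs) \<diamondop> arrow_path Q \<beta>"
      by (simp add: qv path concat_path_def arrow_path_def)
    then have "xs = []"
      using minimal[OF T[OF \<beta>] path(3)] by (cases xs) auto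
    then have "q = arrow_path Q \<beta>" by (simp add: qv path arrow_path_def)
    then show "q \<in> ?B" using \<beta> path(1) by blast
  }
  {
    fix q assume "q \<in> ?B"
    then obtain \<beta> where \<beta>: "q = arrow_path Q \<beta>" "(\<beta>, \<alpha>) \<in> arcs R" by blast
    have "q \<noteq> p' \<diamondop> r" if "r \<in> ?T" "nontrivial p'" for r p'
    proof
      assume "q = p' \<diamondop> r"
      then have "[\<beta>] = snd r @ snd p'" by (simp add: \<beta> arrow_path_def concat_path_def)
      then have "snd r = []" using that(2) by (cases "snd r") auto
      then show False using that(1) nonzero_times_arrow_zero_iff[of r \<alpha>] \<alpha> by auto
    qed
    then show "q \<in> L_set K Q I (arrow_path Q \<alpha>)"
      using T[OF \<beta>(2)] \<beta>(1) unfolding L_set_def right_minimal_def by blast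
  }
qed

lemma R_set_arrow:
  assumes \<alpha>: "\<alpha> \<in> arcs Q"
  shows "R_set K Q I (arrow_path Q \<alpha>) = arrow_path Q ` {\<beta> \<in> arcs Q. (\<alpha>, \<beta>) \<in> arcs R}"
    (is "_ = ?B")
proof (intro equalityI subsetI)
  let ?T = "{q \<in> nonzero_paths K Q I. target Q q = source (arrow_path Q \<alpha>) \<and>
    arrow_path Q \<alpha> \<diamondop> q \<in> zero_paths K Q I}"
  have T: "arrow_path Q \<beta> \<in> ?T" if "(\<alpha>, \<beta>) \<in> arcs R" for \<beta>
    using that arrow_path_nonzero arrow_product_zero_iff by (auto simp: relation_arc_iff)
  {
    fix q assume "q \<in> R_set K Q I (arrow_path Q \<alpha>)"
    then have q: "q \<in> ?T" and minimal: "\<And>r p'. r \<in> ?T \<Longrightarrow> p' \<in> paths Q \<Longrightarrow> nontrivial p' \<Longrightarrow>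
        source r = target Q p' \<Longrightarrow> q \<noteq> r \<diamondop> p'"
      unfolding R_set_def left_minimal_def by blast+
    then have "snd q \<noteq> []" "(\<alpha>, last (snd q)) \<in> arcs R"
      using arrow_times_nonzero_zero_iff[of q \<alpha>] \<alpha> by auto
    then obtain v \<beta> xs where qv: "q = (v, xs @ [\<beta>])" and \<beta>: "(\<alpha>, \<beta>) \<in> arcs R"
      by (cases q; cases "snd q" rule: rev_cases) auto
    have path: "\<beta> \<in> arcs Q" "target Q (v, xs) = tail Q \<beta>" "(v, xs) \<in> paths Q"
      using q by (auto simp: qv nonzero_path_iff paths_append_iff paths_Cons_iff)
    have "q = arrow_path Q \<beta> \<diamondop> (v, xs)"
      by (simp add: qv concat_path_def arrow_path_def)
    then have "xs = []"
      using minimal[OF T[OF \<beta>] path(3)] path(2) by (cases xs) auto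
    then have "q = arrow_path Q \<beta>" using path by (simp add: qv arrow_path_def)
    then show "q \<in> ?B" using \<beta> path(1) by blast
  }
  {
    fix q assume "q \<in> ?B"
    then obtain \<beta> where \<beta>: "q = arrow_path Q \<beta>" "(\<alpha>, \<beta>) \<in> arcs R" by blast
    have "q \<noteq> r \<diamondop> p'" if "r \<in> ?T" "nontrivial p'" for r p'
    proof
      assume "q = r \<diamondop> p'"
      then have "[\<beta>] = snd p' @ snd r" by (simp add: \<beta> arrow_path_def concat_path_def)
      then have "snd r = []" using that(2) by (cases "snd p'") auto
      then show False using that(1) arrow_times_nonzero_zero_iff[of r \<alpha>] \<alpha> by auto
    qed
    then show "q \<in> R_set K Q I (arrow_path Q \<alpha>)"
      using T[OF \<beta>(2)] \<beta>(1) unfolding R_set_def left_minimal_def by blast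
  }
qed

lemma perfect_pair_factor:
  assumes "perfect_pair K Q I p q"
  shows "r \<in> nonzero_paths K Q I \<Longrightarrow> target Q r = source p \<Longrightarrow> p \<diamondop> r \<in> zero_paths K Q I \<Longrightarrow>
      \<exists>r'. r = q \<diamondop> r'"
    and "r \<in> nonzero_paths K Q I \<Longrightarrow> source r = target Q q \<Longrightarrow> r \<diamondop> q \<in> zero_paths K Q I \<Longrightarrow>
      \<exists>r'. r = r' \<diamondop> p"
  using assms unfolding perfect_pair_def by blast+

text \<open>
  The two divisibility conditions on a perfect pair need only be tested on single arrows,
  because only the arrow adjacent to \<open>\<alpha>\<close> or \<open>\<beta>\<close> decides whether a product with it vanishes.
\<close>

lemma perfect_pair_arrows_iff:
  assumes \<alpha>: "\<alpha> \<in> arcs Q" and \<beta>: "\<beta> \<in> arcs Q"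
  shows "perfect_pair K Q I (arrow_path Q \<alpha>) (arrow_path Q \<beta>) \<longleftrightarrow> exclusive_arc R (\<alpha>, \<beta>)"
proof
  assume perf: "perfect_pair K Q I (arrow_path Q \<alpha>) (arrow_path Q \<beta>)"
  then have ab: "(\<alpha>, \<beta>) \<in> arcs R"
    using arrow_product_zero_iff[OF \<beta> \<alpha>] by (simp add: perfect_pair_def)
  have right: "\<gamma> = \<beta>" if ag: "(\<alpha>, \<gamma>) \<in> arcs R" for \<gamma>
  proof -
    have \<gamma>: "\<gamma> \<in> arcs Q" "head Q \<gamma> = tail Q \<alpha>" using ag by (simp_all add: relation_arc_iff)
    then obtain q where "arrow_path Q \<gamma> = arrow_path Q \<beta> \<diamondop> q"
      using perfect_pair_factor(1)[OF perf arrow_path_nonzero[OF \<gamma>(1)]] ag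
        arrow_product_zero_iff[OF \<gamma>(1) \<alpha>] by auto
    then show ?thesis by (cases "snd q") (auto simp: arrow_path_def concat_path_def)
  qed
  have left: "\<gamma> = \<alpha>" if ag: "(\<gamma>, \<beta>) \<in> arcs R" for \<gamma>
  proof -
    have \<gamma>: "\<gamma> \<in> arcs Q" "head Q \<beta> = tail Q \<gamma>" using ag by (simp_all add: relation_arc_iff)
    then obtain q where "arrow_path Q \<gamma> = q \<diamondop> arrow_path Q \<alpha>"
      using perfect_pair_factor(2)[OF perf arrow_path_nonzero[OF \<gamma>(1)]] ag
        arrow_product_zero_iff[OF \<beta> \<gamma>(1)] by auto
    then show ?thesis by (auto simp: arrow_path_def concat_path_def)
  qed
  have "e = (\<alpha>, \<beta>)" if "e \<in> arcs R" "snd e = \<beta> \<or> fst e = \<alpha>" for e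
    using that left[of "fst e"] right[of "snd e"] by (metis prod.collapse)
  then show "exclusive_arc R (\<alpha>, \<beta>)"
    using ab unfolding exclusive_arc_iff relation_quiver_simps fst_conv snd_conv by blast
next
  assume excl: "exclusive_arc R (\<alpha>, \<beta>)"
  then have ab: "(\<alpha>, \<beta>) \<in> arcs R" by (simp add: exclusive_arc_def)
  then have st: "head Q \<beta> = tail Q \<alpha>" by (simp add: relation_arc_iff)
  have "\<exists>q'' \<in> paths Q. tail Q \<beta> = target Q q'' \<and> q = arrow_path Q \<beta> \<diamondop> q''"
    if q: "q \<in> nonzero_paths K Q I" "target Q q = tail Q \<alpha>" "arrow_path Q \<alpha> \<diamondop> q \<in> zero_paths K Q I"
    for q
  proof -
    have "snd q \<noteq> []" "(\<alpha>, last (snd q)) \<in> arcs R"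
      using q arrow_times_nonzero_zero_iff[OF q(1) \<alpha>] by auto
    moreover from this have "last (snd q) = \<beta>"
      using exclusive_arc_unique[OF excl, of "(\<alpha>, last (snd q))"] by simp
    ultimately obtain v xs where qv: "q = (v, xs @ [\<beta>])"
      by (metis append_butlast_last_id prod.collapse)
    then have "(v, xs) \<in> paths Q" "tail Q \<beta> = target Q (v, xs)"
      using q(1) by (auto simp: nonzero_path_iff paths_append_iff paths_Cons_iff)
    then show ?thesis
      by (intro bexI[of _ "(v, xs)"]) (simp_all add: qv arrow_path_def concat_path_def)
  qed
  moreover have "\<exists>p'' \<in> paths Q. source p'' = head Q \<alpha> \<and> p = p'' \<diamondop> arrow_path Q \<alpha>"
    if p: "p \<in> nonzero_paths K Q I" "source p = head Q \<beta>" "p \<diamondop> arrow_path Q \<beta> \<in> zero_paths K Q I"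
    for p
  proof -
    have "snd p \<noteq> []" "(hd (snd p), \<beta>) \<in> arcs R"
      using p nonzero_times_arrow_zero_iff[OF p(1) \<beta>] by auto
    moreover from this have "hd (snd p) = \<alpha>"
      using exclusive_arc_unique[OF excl, of "(hd (snd p), \<beta>)"] by simp
    ultimately obtain v xs where pv: "p = (v, \<alpha> # xs)"
      by (metis list.collapse prod.collapse)
    then have "(head Q \<alpha>, xs) \<in> paths Q" "v = tail Q \<alpha>"
      using p(1) by (auto simp: nonzero_path_iff paths_Cons_iff)
    then show ?thesis
      by (intro bexI[of _ "(head Q \<alpha>, xs)"]) (simp_all add: pv arrow_path_def concat_path_def)
  qed
  ultimately show "perfect_pair K Q I (arrow_path Q \<alpha>) (arrow_path Q \<beta>)"
    unfolding perfect_pair_def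
    using arrow_path_nonzero[OF \<alpha>] arrow_path_nonzero[OF \<beta>] arrow_product_zero_iff[OF \<beta> \<alpha> st] ab st
    by (simp add: arrow_path_def[of Q \<alpha>] arrow_path_def[of Q \<beta>])
qed

text \<open>
  The last arrow of the partner already annihilates \<open>\<alpha>\<close> from the right, hence has the partner
  as a left factor; this leaves no room for a second arrow.
\<close>

lemma perfect_partner_of_arrow:
  assumes \<alpha>: "\<alpha> \<in> arcs Q" and perf: "perfect_pair K Q I (arrow_path Q \<alpha>) q"
  obtains \<beta> where "\<beta> \<in> arcs Q" "q = arrow_path Q \<beta>"
proof -
  have q: "q \<in> nonzero_paths K Q I" "snd q \<noteq> []" "target Q q = tail Q \<alpha>"
    "arrow_path Q \<alpha> \<diamondop> q \<in> zero_paths K Q I"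
    using perf by (auto simp: perfect_pair_def)
  let ?\<beta> = "last (snd q)"
  have ab: "(\<alpha>, ?\<beta>) \<in> arcs R"
    using arrow_times_nonzero_zero_iff[OF q(1) \<alpha> q(3)] q(4) by simp
  then have \<beta>: "?\<beta> \<in> arcs Q" "head Q ?\<beta> = tail Q \<alpha>" by (simp_all add: relation_arc_iff)
  then obtain r where r: "arrow_path Q ?\<beta> = q \<diamondop> r"
    using perfect_pair_factor(1)[OF perf arrow_path_nonzero[OF \<beta>(1)]] ab
      arrow_product_zero_iff[OF \<beta>(1) \<alpha>] by auto
  then have "[?\<beta>] = snd r @ snd q" by (simp add: arrow_path_def concat_path_def)
  then have "snd q = [?\<beta>]" using q(2) by (cases "snd r") auto
  moreover obtain v where "q = (v, snd q)" by (cases q) simp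
  ultimately have qv: "q = (v, [?\<beta>])" by simp
  then have "(v, [?\<beta>]) \<in> paths Q" using q(1) by (metis nonzero_path_iff)
  then have "v = tail Q ?\<beta>" by (simp add: paths_Cons_iff)
  then have "q = arrow_path Q ?\<beta>" unfolding arrow_path_def using qv by blast
  then show ?thesis using that \<beta>(1) by blast
qed

lemma perfect_path_iff_tranclp:
  "perfect_path K Q I p \<longleftrightarrow> p \<in> nonzero_paths K Q I \<and> (perfect_pair K Q I)\<^sup>+\<^sup>+ p p"
proof -
  have "(\<exists>(n::nat) (ps :: nat \<Rightarrow> ('v, 'a) qpath). 1 \<le> n \<and> ps 1 = p \<and> ps (n + 1) = p \<and>
      (\<forall>i \<in> {1..n}. perfect_pair K Q I (ps i) (ps (i + 1)))) \<longleftrightarrow>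
    (\<exists>(n::nat) > 0. \<exists>f. f 0 = p \<and> f n = p \<and> (\<forall>i<n. perfect_pair K Q I (f i) (f (Suc i))))"
    (is "?L \<longleftrightarrow> ?R")
  proof
    assume ?L
    then obtain n :: nat and ps where n: "1 \<le> n" "ps 1 = p" "ps (n + 1) = p"
      "\<forall>i \<in> {1..n}. perfect_pair K Q I (ps i) (ps (i + 1))" by blast
    then show ?R by (intro exI[of _ n] conjI exI[of _ "\<lambda>i. ps (Suc i)"]) auto
  next
    assume ?R
    then obtain n :: nat and f where n: "n > 0" "f 0 = p" "f n = p"
      "\<forall>i<n. perfect_pair K Q I (f i) (f (Suc i))" by blast
    have "perfect_pair K Q I (f (i - 1)) (f (i + 1 - 1))" if "i \<in> {1..n}" for i
      using that n(4) by (cases i) auto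
    then show ?L
      using n by (intro exI[of _ n] exI[of _ "\<lambda>i. f (i - 1)"] conjI) auto
  qed
  then show ?thesis
    unfolding perfect_path_def tranclp_power relpowp_fun_conv by blast
qed

lemma wf_relation_quiver: "wf_digraph R"
  by unfold_locales (auto simp: relation_arc_iff)

text \<open>
  Perfect pairs run against the arrows of the relation quiver, so a chain of perfect pairs from
  \<open>\<alpha>\<close> to \<open>\<beta>\<close> is a walk from \<open>\<beta>\<close> to \<open>\<alpha>\<close>.
\<close>

lemma perfect_chain_iff_exclusive_awalk:
  assumes \<alpha>: "\<alpha> \<in> arcs Q"
  shows "(perfect_pair K Q I)\<^sup>+\<^sup>+ (arrow_path Q \<alpha>) q \<longleftrightarrow>
    (\<exists>\<beta> \<in> arcs Q. q = arrow_path Q \<beta> \<and>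
      (\<exists>c. pre_digraph.awalk R \<beta> c \<alpha> \<and> c \<noteq> [] \<and> (\<forall>e \<in> set c. exclusive_arc R e)))"
    (is "_ \<longleftrightarrow> ?W q")
proof
  interpret R: wf_digraph R by (rule wf_relation_quiver)
  have arc: "R.awalk \<beta> ((\<gamma>, \<beta>) # c) \<alpha> \<longleftrightarrow> (\<gamma>, \<beta>) \<in> arcs R \<and> R.awalk \<gamma> c \<alpha>" for \<beta> \<gamma> c
    by (auto simp: R.awalk_Cons_iff)
  {
    assume "(perfect_pair K Q I)\<^sup>+\<^sup>+ (arrow_path Q \<alpha>) q"
    then show "?W q"
    proof (induction rule: tranclp_induct)
      case (base q)
      then obtain \<beta> where \<beta>: "\<beta> \<in> arcs Q" "q = arrow_path Q \<beta>"
        using perfect_partner_of_arrow[OF \<alpha>] by blast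
      then have "exclusive_arc R (\<alpha>, \<beta>)" using base perfect_pair_arrows_iff[OF \<alpha>] by blast
      moreover from this have "R.awalk \<beta> [(\<alpha>, \<beta>)] \<alpha>"
        using \<alpha> by (simp add: arc R.awalk_Nil_iff exclusive_arc_def)
      ultimately show ?case using \<beta> by (intro bexI[of _ \<beta>] conjI exI[of _ "[(\<alpha>, \<beta>)]"]) auto
    next
      case (step q r)
      then obtain \<gamma> c where \<gamma>: "\<gamma> \<in> arcs Q" "q = arrow_path Q \<gamma>"
        and c: "R.awalk \<gamma> c \<alpha>" "\<forall>e \<in> set c. exclusive_arc R e" by blast
      then obtain \<beta> where \<beta>: "\<beta> \<in> arcs Q" "r = arrow_path Q \<beta>"
        using perfect_partner_of_arrow[OF \<gamma>(1)] step.hyps(2) by blast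
      then have "exclusive_arc R (\<gamma>, \<beta>)"
        using step.hyps(2) perfect_pair_arrows_iff[OF \<gamma>(1)] \<gamma>(2) by blast
      moreover from this have "R.awalk \<beta> ((\<gamma>, \<beta>) # c) \<alpha>"
        using c(1) by (simp add: arc exclusive_arc_def)
      ultimately show ?case
        using \<beta> c(2) by (intro bexI[of _ \<beta>] conjI exI[of _ "(\<gamma>, \<beta>) # c"]) auto
    qed
  }
  have "(perfect_pair K Q I)\<^sup>+\<^sup>+ (arrow_path Q \<alpha>) (arrow_path Q \<beta>)"
    if "R.awalk \<beta> c \<alpha>" "c \<noteq> []" "\<forall>e \<in> set c. exclusive_arc R e" for \<beta> c
    using that
  proof (induction c arbitrary: \<beta>)
    case (Cons e c)
    obtain \<gamma> where e: "e = (\<gamma>, \<beta>)"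
      using Cons.prems(1) by (cases e) (simp add: R.awalk_Cons_iff)
    have walk: "(\<gamma>, \<beta>) \<in> arcs R" "R.awalk \<gamma> c \<alpha>" using Cons.prems(1) by (simp_all add: e arc)
    then have pair: "perfect_pair K Q I (arrow_path Q \<gamma>) (arrow_path Q \<beta>)"
      using Cons.prems(3) perfect_pair_arrows_iff by (simp add: e relation_arc_iff)
    show ?case
    proof (cases "c = []")
      case True
      then show ?thesis using walk(2) pair by (auto simp: R.awalk_Nil_iff)
    next
      case False
      then show ?thesis using Cons.IH[OF walk(2)] Cons.prems(3) pair by auto
    qed
  qed simp
  then show "(perfect_pair K Q I)\<^sup>+\<^sup>+ (arrow_path Q \<alpha>) q" if "?W q"
    using that by blast
qed

lemma perfect_arrow_iff_perfect_component:
  assumes \<alpha>: "\<alpha> \<in> arcs Q"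
  shows "perfect_path K Q I (arrow_path Q \<alpha>) \<longleftrightarrow> (\<exists>C. perfect_component K Q I C \<and> \<alpha> \<in> verts C)"
proof -
  interpret R: wf_digraph R by (rule wf_relation_quiver)
  have inj: "arrow_path Q \<alpha> = arrow_path Q \<beta> \<longleftrightarrow> \<alpha> = \<beta>" for \<beta>
    by (auto simp: arrow_path_def)
  have "perfect_path K Q I (arrow_path Q \<alpha>) \<longleftrightarrow>
      (\<exists>c. R.awalk \<alpha> c \<alpha> \<and> c \<noteq> [] \<and> (\<forall>e \<in> set c. exclusive_arc R e))"
    using arrow_path_nonzero[OF \<alpha>] \<alpha>
    by (simp add: perfect_path_iff_tranclp perfect_chain_iff_exclusive_awalk inj)
  also have "\<dots> \<longleftrightarrow> (\<exists>C. perfect_component K Q I C \<and> \<alpha> \<in> verts C)"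
  proof
    assume "\<exists>c. R.awalk \<alpha> c \<alpha> \<and> c \<noteq> [] \<and> (\<forall>e \<in> set c. exclusive_arc R e)"
    then obtain c where "R.awalk \<alpha> c \<alpha>" "c \<noteq> []" "\<And>e. e \<in> set c \<Longrightarrow> exclusive_arc R e"
      by blast
    then show "\<exists>C. perfect_component K Q I C \<and> \<alpha> \<in> verts C"
      unfolding perfect_component_def using R.exclusive_closed_awalk_component[of \<alpha> c] by blast
  next
    assume "\<exists>C. perfect_component K Q I C \<and> \<alpha> \<in> verts C"
    then obtain C n where "R.max_subgraph connected C" "basic_cycle n C" "\<alpha> \<in> verts C"
      unfolding perfect_component_def by blast
    then show "\<exists>c. R.awalk \<alpha> c \<alpha> \<and> c \<noteq> [] \<and> (\<forall>e \<in> set c. exclusive_arc R e)"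
      by (rule R.basic_cycle_component_awalk)
  qed
  finally show ?thesis .
qed

end

theorem lemma5p3:
  fixes K :: "('k, 'm) ring_scheme"
    and Q :: "('v, 'a) pre_digraph"
    and I :: "(('v, 'a) qpath \<Rightarrow> 'k) set"
    and \<alpha> :: 'a
  assumes "field K" and "fin_digraph Q" and "quadratic_monomial K Q I" and "\<alpha> \<in> arcs Q"
  shows
    "L_set K Q I (arrow_path Q \<alpha>) =
       arrow_path Q ` {\<beta> \<in> arcs Q. tail Q \<beta> = head Q \<alpha> \<and>
                         arrow_path Q \<beta> \<diamondop> arrow_path Q \<alpha> \<in> \<^bold>F K Q I} \<and>
     R_set K Q I (arrow_path Q \<alpha>) =
       arrow_path Q ` {\<beta> \<in> arcs Q. head Q \<beta> = tail Q \<alpha> \<and>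
                         arrow_path Q \<alpha> \<diamondop> arrow_path Q \<beta> \<in> \<^bold>F K Q I} \<and>
     (\<forall>\<beta> \<in> arcs Q. head Q \<beta> = tail Q \<alpha> \<longrightarrow>
       (perfect_pair K Q I (arrow_path Q \<alpha>) (arrow_path Q \<beta>) \<longleftrightarrow>
         (\<alpha>, \<beta>) \<in> arcs (relation_quiver K Q I) \<and>
         out_arcs (relation_quiver K Q I) \<beta> = {(\<alpha>, \<beta>)} \<and>
         in_arcs (relation_quiver K Q I) \<alpha> = {(\<alpha>, \<beta>)})) \<and>
     (perfect_path K Q I (arrow_path Q \<alpha>) \<longleftrightarrow>
       (\<exists>C. perfect_component K Q I C \<and> \<alpha> \<in> verts C))"
proof -
  interpret quadratic_monomial_quiver K Q I
    using assms by (simp add: quadratic_monomial_quiver_def quadratic_monomial_quiver_axioms_def)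
  note \<alpha> = \<open>\<alpha> \<in> arcs Q\<close>
  have "{\<beta> \<in> arcs Q. (\<beta>, \<alpha>) \<in> arcs R} =
      {\<beta> \<in> arcs Q. tail Q \<beta> = head Q \<alpha> \<and> arrow_path Q \<beta> \<diamondop> arrow_path Q \<alpha> \<in> \<^bold>F K Q I}"
    using \<alpha> arrow_product_minimal_iff[of \<alpha>] by (auto simp: relation_arc_iff)
  note L = L_set_arrow[OF \<alpha>, unfolded this]
  have "{\<beta> \<in> arcs Q. (\<alpha>, \<beta>) \<in> arcs R} =
      {\<beta> \<in> arcs Q. head Q \<beta> = tail Q \<alpha> \<and> arrow_path Q \<alpha> \<diamondop> arrow_path Q \<beta> \<in> \<^bold>F K Q I}"
    using \<alpha> arrow_product_minimal_iff[of _ \<alpha>] by (auto simp: relation_arc_iff)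
  note R = R_set_arrow[OF \<alpha>, unfolded this]
  have "perfect_pair K Q I (arrow_path Q \<alpha>) (arrow_path Q \<beta>) \<longleftrightarrow>
      (\<alpha>, \<beta>) \<in> arcs R \<and> out_arcs R \<beta> = {(\<alpha>, \<beta>)} \<and> in_arcs R \<alpha> = {(\<alpha>, \<beta>)}"
    if "\<beta> \<in> arcs Q" for \<beta>
    using perfect_pair_arrows_iff[OF \<alpha> that] by (simp add: exclusive_arc_def)
  then show ?thesis
    by (intro conjI ballI impI L R perfect_arrow_iff_perfect_component[OF \<alpha>])
qed

end
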